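(* Suppose that assumptions (H1), (H2) and (H3) stated in the context hold and let $p\in[1,+\infty]$. Endow the linear spaces $X$ and $Y:=\{y\in X:y(z)=0,\ z\in\partial G\}$ with the norm $\|\cdot\|_p$. Consider the boundary-input problem $$\text{(BI)}\quad (Lx)(t,z)=0\ \text{ on }(0,+\infty)\times G,\quad x(0,z)=x_0(z)\ \text{ on }G,\quad x(t,z)=u(t,z)\ \text{ on }\mathbb{R}_+\times\partial G,$$ and the distributed-input problem $$\text{(DI)}\quad \frac{\partial y}{\partial t}(t,z)-\sum_{i,j=1}^na_{i,j}(z)\frac{\partial^2y}{\partial z_i\partial z_j}(t,z)-f\big(z,y(t,z)+v(t,z),\nabla y(t,z)\big)=0\ \text{ for } t>0,\ z\in G,\qquad y(t,z)=0\ \text{ for } z\in\partial G,\ t\ge0.$$ The following statements are equivalent: (i) The system (BI) with the state space $X$ is ISS with respect to inputs of class $\mathcal{U}$. (ii) The system (BI) with the state space $X$ is ISS with respect to the constant in time and space inputs of class $\mathcal{U}$. (iii) The system (DI) with the state space $Y$ is ISS with respect to inputs in $\mathcal{V}$.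
   Context: Setting. $\mathbb{R}_+=[0,\infty)$; $G\subset\mathbb{R}^n$ is an open bounded region; $CL$ is the class of functions $x\in C^0(\mathbb{R}_+\times\overline{G})\cap C^{1,2}((0,+\infty)\times G)$, where $C^{1,2}$ means continuously differentiable in $t$ with continuous second derivatives in $z$. For $x\in CL$, $$(Lx)(t,z):=\frac{\partial x}{\partial t}(t,z)-\sum_{i,j=1}^n a_{i,j}(z)\frac{\partial^2x}{\partial z_i\partial z_j}(t,z)-f\big(z,x(t,z),\nabla x(t,z)\big),$$ with $a_{i,j}\in C^0(\overline{G})$ and $f\in C^0(\overline{G}\times\mathbb{R}\times\mathbb{R}^n)$. $L$ is assumed uniformly parabolic: there is $K>0$ with $\sum_{i,j}a_{i,j}(z)\xi_i\xi_j\ge K|\xi|^2$ for all $\xi\in\mathbb{R}^n$, $z\in\overline{G}$. Inputs. $U=C^0(\partial G)$ with the sup-norm, $\mathcal{U}:=\{u\in C^0(\mathbb{R}_+;U): u \text{ bounded}\}$ with $\|u\|_{\mathcal{U}}=\sup_{t\ge0,\,z\in\partial G}|u(t,z)|$. The constant in time and space inputs form $\mathcal{U}_c:=\{u\in\mathcal{U}:\exists k\in\mathbb{R}:\ u(t,z)=k\ \forall(t,z)\in\mathbb{R}_+\times\partial G\}$. $\mathcal{V}:=\{v\in C^0(\mathbb{R}_+\times\overline{G},\mathbb{R}):\exists k\in\mathbb{R}:\ v(t,z)=k\ \forall(t,z)\in\mathbb{R}_+\times\overline{G}\}$ with the sup-norm. $\|x\|_p=(\int_G|x(z)|^pdz)^{1/p}$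 for $p<\infty$, and $\|x\|_\infty$ is the (essential) supremum of $|x|$ over $G$. (H1) There is a linear space $X\subseteq C^0(\overline{G})$ containing all constant functions, and for each $x_0\in X$ a nonempty set of (admissible) inputs $\mathcal{U}(x_0)\subseteq\{v\in\mathcal{U}: v(0,z)=x_0(z)\text{ for }z\in\partial G\}$, such that: if $x_0\in X$ is constant on $\partial G$, then $\mathcal{U}(x_0)$ contains the input $v$ given by $v(t,z)=x_0(z)$ for $z\in\partial G$, $t\ge0$; and for every $x_0\in X$, $u\in\mathcal{U}(x_0)$ there exists a solution $x\in CL$ of (BI) with $x[t]:=x(t,\cdot)\in X$ for all $t\ge0$. The sets of admissible inputs are compatible with time shifts: $u(t+\cdot)\in\mathcal{U}(x[t])$ for all $t\ge0$, $x_0\in X$, $u\in\mathcal{U}(x_0)$. (H2) For every bounded set $W\subset\mathbb{R}$ there is $k>0$ such that $f(z,w_1,\xi)-f(z,w_2,\xi)<k(w_1-w_2)$ for all $w_1,w_2\in W$ with $w_1>w_2$, $z\in G$, $\xi\in\mathbb{R}^n$. Moreover, $(z,w,\xi)\mapsto f(z,w,\xi)$ on $\overline{G}\times\mathbb{R}\times\mathbb{R}^n$ is continuously differentiable with respect to $w\in\mathbb{R}$ and $\xi\in\mathbb{R}^n$. (H3) For every $\delta>0$, $a\in\mathbb{R}$, $x\in X$ there is a continuous function $k:\overline{G}\to[0,1]$ with $k(z)=1$ for $z\in\partial G$, $k(z)=0$ for all $z\in G$ whose Euclidean distance to $\partial G$ is at least $\delta$, and such that the function $z\mapsto(1-k(z))x(z)+a\,k(z)$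 belongs to $X$. Solution maps. $\phi(t,x_0,u):=x[t]$ denotes the state at time $t$ of the solution $x\in CL$ of (BI) for $x_0\in X$, $u\in\mathcal{U}(x_0)$. $\phi_y(t,y_0,v)$ denotes the state at time $t$ of the solution (in $CL$) of (DI) with initial condition $y_0\in Y$ and input $v\in\mathcal{V}$ (all $v\in\mathcal{V}$ are admissible for all $y_0\in Y$); one has $\phi_y(t,y_0,v)=\phi(t,x,v|_{\partial G})-v$ with $x=y_0+v$. ISS. $\mathcal{K}$ is the set of continuous strictly increasing $\gamma:\mathbb{R}_+\to\mathbb{R}_+$ with $\gamma(0)=0$; $\mathcal{KL}$ is the set of continuous $\beta:\mathbb{R}_+\times\mathbb{R}_+\to\mathbb{R}_+$ with $\beta(\cdot,t)\in\mathcal{K}$ for all $t\ge0$ and, for all $r>0$, $\beta(r,\cdot)$ strictly decreasing with limit $0$ at infinity. A system with state space $X$, admissible input sets $\mathcal{U}(x)$ and transition map $\phi$ is ISS with respect to inputs in a set $\mathcal{W}$ if there exist $\beta\in\mathcal{KL}$, $\gamma\in\mathcal{K}$ such that for every $x\in X$ with $\mathcal{U}(x)\cap\mathcal{W}\ne\emptyset$, all $u\in\mathcal{U}(x)\cap\mathcal{W}$ and all $t\ge0$: $\|\phi(t,x,u)\|\le\beta(\|x\|,t)+\gamma(\|u\|)$, where states are measured in the norm of the state space and inputs in the norm of the input space. *)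

theory Defs
  imports "HOL-Analysis.Analysis" "HOL-Probability.Essential_Supremum"
begin

text \<open>
  A function whose domain is a proper subset of a type is represented by its extension by 0, so that
  equality of representatives is equality of functions on the intended domain. Functions
  of time and space are curried; in particular the state \<open>x[t]\<close> is \<open>x t\<close>.
\<close>

definition ext0 :: "'a set \<Rightarrow> ('a \<Rightarrow> real) \<Rightarrow> 'a \<Rightarrow> real" where
  "ext0 S g = (\<lambda>z. if z \<in> S then g z else 0)"

definition ext0_time :: "'a set \<Rightarrow> (real \<Rightarrow> 'a \<Rightarrow> real) \<Rightarrow> real \<Rightarrow> 'a \<Rightarrow> real" where
  "ext0_time S g = (\<lambda>t z. if 0 \<le> t \<and> z \<in> S then g t z else 0)"

definition C0 :: "'a::topological_space set \<Rightarrow> ('a \<Rightarrow> real) set" where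
  "C0 S = {g. continuous_on S g \<and> ext0 S g = g}"

definition C0_time :: "'a::topological_space set \<Rightarrow> (real \<Rightarrow> 'a \<Rightarrow> real) set" where
  "C0_time S = {x. continuous_on ({0..} \<times> S) (\<lambda>(t, z). x t z) \<and> ext0_time S x = x}"


subsection \<open>Partial derivatives and the class of solutions\<close>

definition has_partial :: "'n::finite \<Rightarrow> (real^'n \<Rightarrow> real) \<Rightarrow> real^'n \<Rightarrow> bool" where
  "has_partial i g z \<longleftrightarrow> (\<lambda>s. g (z + s *\<^sub>R axis i 1)) field_differentiable (at 0)"

definition partial :: "'n::finite \<Rightarrow> (real^'n \<Rightarrow> real) \<Rightarrow> real^'n \<Rightarrow> real" where
  "partial i g z = deriv (\<lambda>s. g (z + s *\<^sub>R axis i 1)) 0"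

definition grad :: "(real^'n::finite \<Rightarrow> real) \<Rightarrow> real^'n \<Rightarrow> real^'n" where
  "grad g z = (\<chi> i. partial i g z)"

definition C12 :: "(real^'n::finite) set \<Rightarrow> (real \<Rightarrow> real^'n \<Rightarrow> real) \<Rightarrow> bool" where
  "C12 G x \<longleftrightarrow>
     (\<forall>t>0. \<forall>z\<in>G. (\<lambda>s. x s z) field_differentiable (at t) \<and>
        (\<forall>i. has_partial i (x t) z) \<and> (\<forall>i j. has_partial i (partial j (x t)) z)) \<and>
     continuous_on ({0<..} \<times> G) (\<lambda>(t, z). deriv (\<lambda>s. x s z) t) \<and>
     (\<forall>i. continuous_on ({0<..} \<times> G) (\<lambda>(t, z). partial i (x t) z)) \<and>
     (\<forall>i j. continuous_on ({0<..} \<times> G) (\<lambda>(t, z). partial i (partial j (x t)) z))"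

definition CL :: "(real^'n::finite) set \<Rightarrow> (real \<Rightarrow> real^'n \<Rightarrow> real) set" where
  "CL G = {x \<in> C0_time (closure G). C12 G x}"


subsection \<open>The differential operator and the two problems\<close>

definition parabolic_setting ::
    "(real^'n::finite) set \<Rightarrow> ('n \<Rightarrow> 'n \<Rightarrow> real^'n \<Rightarrow> real) \<Rightarrow>
     (real^'n \<Rightarrow> real \<Rightarrow> real^'n \<Rightarrow> real) \<Rightarrow> bool" where
  "parabolic_setting G a f \<longleftrightarrow>
     G \<noteq> {} \<and> open G \<and> connected G \<and> bounded G \<and>
     (\<forall>i j. continuous_on (closure G) (a i j)) \<and>
     continuous_on (closure G \<times> UNIV \<times> UNIV) (\<lambda>(z, w, \<xi>). f z w \<xi>) \<and>
     (\<exists>K>0. \<forall>z\<in>closure G. \<forall>\<xi>::real^'n.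
        (\<Sum>i\<in>UNIV. \<Sum>j\<in>UNIV. a i j z * (\<xi> $ i) * (\<xi> $ j)) \<ge> K * (norm \<xi>)\<^sup>2)"

definition L_op ::
    "('n::finite \<Rightarrow> 'n \<Rightarrow> real^'n \<Rightarrow> real) \<Rightarrow> (real^'n \<Rightarrow> real \<Rightarrow> real^'n \<Rightarrow> real) \<Rightarrow>
     (real \<Rightarrow> real^'n \<Rightarrow> real) \<Rightarrow> real \<Rightarrow> real^'n \<Rightarrow> real" where
  "L_op a f x t z = deriv (\<lambda>s. x s z) t
     - (\<Sum>i\<in>UNIV. \<Sum>j\<in>UNIV. a i j z * partial i (partial j (x t)) z)
     - f z (x t z) (grad (x t) z)"

definition BI_solution ::
    "(real^'n::finite) set \<Rightarrow> ('n \<Rightarrow> 'n \<Rightarrow> real^'n \<Rightarrow> real) \<Rightarrow>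
     (real^'n \<Rightarrow> real \<Rightarrow> real^'n \<Rightarrow> real) \<Rightarrow> (real^'n \<Rightarrow> real) \<Rightarrow>
     (real \<Rightarrow> real^'n \<Rightarrow> real) \<Rightarrow> (real \<Rightarrow> real^'n \<Rightarrow> real) \<Rightarrow> bool" where
  "BI_solution G a f x0 u x \<longleftrightarrow> x \<in> CL G \<and>
     (\<forall>t>0. \<forall>z\<in>G. L_op a f x t z = 0) \<and>
     (\<forall>z\<in>G. x 0 z = x0 z) \<and>
     (\<forall>t\<ge>0. \<forall>z\<in>frontier G. x t z = u t z)"

definition DI_solution ::
    "(real^'n::finite) set \<Rightarrow> ('n \<Rightarrow> 'n \<Rightarrow> real^'n \<Rightarrow> real) \<Rightarrow>
     (real^'n \<Rightarrow> real \<Rightarrow> real^'n \<Rightarrow> real) \<Rightarrow> (real^'n \<Rightarrow> real) \<Rightarrow>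
     (real \<Rightarrow> real^'n \<Rightarrow> real) \<Rightarrow> (real \<Rightarrow> real^'n \<Rightarrow> real) \<Rightarrow> bool" where
  "DI_solution G a f y0 v y \<longleftrightarrow> y \<in> CL G \<and>
     (\<forall>t>0. \<forall>z\<in>G. deriv (\<lambda>s. y s z) t
        - (\<Sum>i\<in>UNIV. \<Sum>j\<in>UNIV. a i j z * partial i (partial j (y t)) z)
        - f z (y t z + v t z) (grad (y t) z) = 0) \<and>
     (\<forall>z\<in>G. y 0 z = y0 z) \<and>
     (\<forall>t\<ge>0. \<forall>z\<in>frontier G. y t z = 0)"

text \<open>Solutions of both problems are unique under the one-sided Lipschitz condition in \<open>H2\<close>
  below (comparison principle).\<close>

definition BI_flow ::
    "(real^'n::finite) set \<Rightarrow> ('n \<Rightarrow> 'n \<Rightarrow> real^'n \<Rightarrow> real) \<Rightarrow>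
     (real^'n \<Rightarrow> real \<Rightarrow> real^'n \<Rightarrow> real) \<Rightarrow>
     real \<Rightarrow> (real^'n \<Rightarrow> real) \<Rightarrow> (real \<Rightarrow> real^'n \<Rightarrow> real) \<Rightarrow> real^'n \<Rightarrow> real" where
  "BI_flow G a f t x0 u = (THE x. BI_solution G a f x0 u x) t"

definition DI_flow ::
    "(real^'n::finite) set \<Rightarrow> ('n \<Rightarrow> 'n \<Rightarrow> real^'n \<Rightarrow> real) \<Rightarrow>
     (real^'n \<Rightarrow> real \<Rightarrow> real^'n \<Rightarrow> real) \<Rightarrow>
     real \<Rightarrow> (real^'n \<Rightarrow> real) \<Rightarrow> (real \<Rightarrow> real^'n \<Rightarrow> real) \<Rightarrow> real^'n \<Rightarrow> real" where
  "DI_flow G a f t y0 v = (THE y. DI_solution G a f y0 v y) t"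


subsection \<open>Inputs and norms\<close>

text \<open>Continuity of \<open>t \<mapsto> u(t,\<cdot>)\<close> into \<open>C\<^sup>0(\<partial>G)\<close> with the sup-norm is expressed
  by uniform limits.\<close>

definition boundary_inputs :: "(real^'n::finite) set \<Rightarrow> (real \<Rightarrow> real^'n \<Rightarrow> real) set" where
  "boundary_inputs G = {u. ext0_time (frontier G) u = u \<and>
     (\<forall>t\<ge>0. u t \<in> C0 (frontier G)) \<and>
     (\<forall>t\<ge>0. uniform_limit (frontier G) u (u t) (at t within {0..})) \<and>
     (\<exists>M. \<forall>t\<ge>0. \<forall>z\<in>frontier G. \<bar>u t z\<bar> \<le> M)}"

definition const_boundary_inputs :: "(real^'n::finite) set \<Rightarrow> (real \<Rightarrow> real^'n \<Rightarrow> real) set" where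
  "const_boundary_inputs G =
     {u \<in> boundary_inputs G. \<exists>k. \<forall>t\<ge>0. \<forall>z\<in>frontier G. u t z = k}"

definition const_distributed_inputs :: "(real^'n::finite) set \<Rightarrow> (real \<Rightarrow> real^'n \<Rightarrow> real) set" where
  "const_distributed_inputs G =
     {v \<in> C0_time (closure G). \<exists>k. \<forall>t\<ge>0. \<forall>z\<in>closure G. v t z = k}"

definition sup_norm_time :: "'a set \<Rightarrow> (real \<Rightarrow> 'a \<Rightarrow> real) \<Rightarrow> real" where
  "sup_norm_time S u = (SUP (t, z)\<in>{0..} \<times> S. \<bar>u t z\<bar>)"

definition Lp_norm :: "ereal \<Rightarrow> (real^'n::finite) set \<Rightarrow> (real^'n \<Rightarrow> real) \<Rightarrow> real" where
  "Lp_norm p G x =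
     (if p = \<infinity> then real_of_ereal (esssup (restrict_space lborel G) (\<lambda>z. ereal \<bar>x z\<bar>))
      else (LINT z:G|lborel. \<bar>x z\<bar> powr real_of_ereal p) powr (1 / real_of_ereal p))"


subsection \<open>The standing assumptions\<close>

definition shift_input :: "real \<Rightarrow> (real \<Rightarrow> 'a \<Rightarrow> real) \<Rightarrow> real \<Rightarrow> 'a \<Rightarrow> real" where
  "shift_input t u = ext0_time UNIV (\<lambda>s. u (t + s))"

definition H1 ::
    "(real^'n::finite) set \<Rightarrow> ('n \<Rightarrow> 'n \<Rightarrow> real^'n \<Rightarrow> real) \<Rightarrow>
     (real^'n \<Rightarrow> real \<Rightarrow> real^'n \<Rightarrow> real) \<Rightarrow> (real^'n \<Rightarrow> real) set \<Rightarrow>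
     ((real^'n \<Rightarrow> real) \<Rightarrow> (real \<Rightarrow> real^'n \<Rightarrow> real) set) \<Rightarrow> bool" where
  "H1 G a f X Uad \<longleftrightarrow>
     X \<subseteq> C0 (closure G) \<and>
     (\<forall>x\<in>X. \<forall>y\<in>X. (\<lambda>z. x z + y z) \<in> X) \<and>
     (\<forall>c. \<forall>x\<in>X. (\<lambda>z. c * x z) \<in> X) \<and>
     (\<forall>c. ext0 (closure G) (\<lambda>z. c) \<in> X) \<and>
     (\<forall>x0\<in>X. Uad x0 \<noteq> {} \<and>
        Uad x0 \<subseteq> {v \<in> boundary_inputs G. \<forall>z\<in>frontier G. v 0 z = x0 z}) \<and>
     (\<forall>x0\<in>X. (\<exists>c. \<forall>z\<in>frontier G. x0 z = c) \<longrightarrow> ext0_time (frontier G) (\<lambda>t. x0) \<in> Uad x0) \<and>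
     (\<forall>x0\<in>X. \<forall>u\<in>Uad x0. \<exists>x. BI_solution G a f x0 u x \<and>
        (\<forall>t\<ge>0. x t \<in> X \<and> shift_input t u \<in> Uad (x t)))"

definition H2 :: "(real^'n::finite) set \<Rightarrow> (real^'n \<Rightarrow> real \<Rightarrow> real^'n \<Rightarrow> real) \<Rightarrow> bool" where
  "H2 G f \<longleftrightarrow>
     (\<forall>W. bounded W \<longrightarrow> (\<exists>k>0. \<forall>w1\<in>W. \<forall>w2\<in>W. w1 > w2 \<longrightarrow>
        (\<forall>z\<in>G. \<forall>\<xi>. f z w1 \<xi> - f z w2 \<xi> < k * (w1 - w2)))) \<and>
     (\<exists>fw f\<xi>.
        (\<forall>z\<in>closure G. \<forall>w \<xi>. ((\<lambda>w. f z w \<xi>) has_real_derivative fw z w \<xi>) (at w) \<and>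
           GDERIV (f z w) \<xi> :> f\<xi> z w \<xi>) \<and>
        continuous_on (closure G \<times> UNIV \<times> UNIV) (\<lambda>(z, w, \<xi>). fw z w \<xi>) \<and>
        continuous_on (closure G \<times> UNIV \<times> UNIV) (\<lambda>(z, w, \<xi>). f\<xi> z w \<xi>))"

definition H3 :: "(real^'n::finite) set \<Rightarrow> (real^'n \<Rightarrow> real) set \<Rightarrow> bool" where
  "H3 G X \<longleftrightarrow> (\<forall>\<delta>>0. \<forall>c. \<forall>x\<in>X. \<exists>k.
     continuous_on (closure G) k \<and> (\<forall>z\<in>closure G. k z \<in> {0..1}) \<and>
     (\<forall>z\<in>frontier G. k z = 1) \<and>
     (\<forall>z\<in>G. infdist z (frontier G) \<ge> \<delta> \<longrightarrow> k z = 0) \<and>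
     ext0 (closure G) (\<lambda>z. (1 - k z) * x z + c * k z) \<in> X)"


subsection \<open>Input-to-state stability\<close>

definition class_K :: "(real \<Rightarrow> real) set" where
  "class_K = {\<gamma>. continuous_on {0..} \<gamma> \<and> strict_mono_on {0..} \<gamma> \<and> \<gamma> 0 = 0}"

definition class_KL :: "(real \<Rightarrow> real \<Rightarrow> real) set" where
  "class_KL = {\<beta>. continuous_on ({0..} \<times> {0..}) (\<lambda>(r, t). \<beta> r t) \<and>
     (\<forall>t\<ge>0. (\<lambda>r. \<beta> r t) \<in> class_K) \<and>
     (\<forall>r>0. strict_antimono_on {0..} (\<beta> r) \<and> (\<beta> r \<longlongrightarrow> 0) at_top)}"

definition ISS ::
    "'x set \<Rightarrow> ('x \<Rightarrow> real) \<Rightarrow> ('x \<Rightarrow> 'u set) \<Rightarrow> ('u \<Rightarrow> real) \<Rightarrow>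
     (real \<Rightarrow> 'x \<Rightarrow> 'u \<Rightarrow> 'x) \<Rightarrow> 'u set \<Rightarrow> bool" where
  "ISS X normX Uad normU \<phi> W \<longleftrightarrow>
     (\<exists>\<beta>\<in>class_KL. \<exists>\<gamma>\<in>class_K. \<forall>x\<in>X. Uad x \<inter> W \<noteq> {} \<longrightarrow>
        (\<forall>u\<in>Uad x \<inter> W. \<forall>t\<ge>0. normX (\<phi> t x u) \<le> \<beta> (normX x) t + \<gamma> (normU u)))"

definition BI_ISS ::
    "ereal \<Rightarrow> (real^'n::finite) set \<Rightarrow> ('n \<Rightarrow> 'n \<Rightarrow> real^'n \<Rightarrow> real) \<Rightarrow>
     (real^'n \<Rightarrow> real \<Rightarrow> real^'n \<Rightarrow> real) \<Rightarrow> (real^'n \<Rightarrow> real) set \<Rightarrow>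
     ((real^'n \<Rightarrow> real) \<Rightarrow> (real \<Rightarrow> real^'n \<Rightarrow> real) set) \<Rightarrow>
     (real \<Rightarrow> real^'n \<Rightarrow> real) set \<Rightarrow> bool" where
  "BI_ISS p G a f X Uad W =
     ISS X (Lp_norm p G) Uad (sup_norm_time (frontier G)) (BI_flow G a f) W"

definition zero_boundary_states :: "(real^'n::finite) set \<Rightarrow> (real^'n \<Rightarrow> real) set \<Rightarrow>
    (real^'n \<Rightarrow> real) set" where
  "zero_boundary_states G X = {y \<in> X. \<forall>z\<in>frontier G. y z = 0}"

definition DI_ISS ::
    "ereal \<Rightarrow> (real^'n::finite) set \<Rightarrow> ('n \<Rightarrow> 'n \<Rightarrow> real^'n \<Rightarrow> real) \<Rightarrow>
     (real^'n \<Rightarrow> real \<Rightarrow> real^'n \<Rightarrow> real) \<Rightarrow> (real^'n \<Rightarrow> real) set \<Rightarrow>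
     (real \<Rightarrow> real^'n \<Rightarrow> real) set \<Rightarrow> bool" where
  "DI_ISS p G a f Y V =
     ISS Y (Lp_norm p G) (\<lambda>y. const_distributed_inputs G) (sup_norm_time (closure G))
       (DI_flow G a f) V"

end

theory Submission
  imports Defs
begin

text \<open>
  The equation satisfies a comparison principle, and everything else is a consequence.

  Comparison (\<open>comparison_principle\<close>): if two solutions \<open>x\<close>, \<open>y\<close> were ordered
  initially and on the boundary but not everywhere, then \<open>exp (- k t) (x - y)\<close> would have a positive
  maximum on some cylinder \<open>[0,T] \<times> closure G\<close>, at a point with \<open>t > 0\<close> and
  \<open>z\<close> in \<open>G\<close>. There the gradients agree, the elliptic part of \<open>x - y\<close> is
  nonpositive (\<open>elliptic_operator_nonpos_at_max\<close>) and the time derivative of \<open>x - y\<close> is at least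
  \<open>k (x - y)\<close>; the one-sided Lipschitz inequality is strict, so the equation is violated.
  In particular solutions are unique, which is what makes the solution maps meaningful.

  From constant boundary inputs to arbitrary ones: let \<open>m\<close> exceed the norm \<open>M\<close> of the input
  \<open>u\<close>. Modifying the initial state in a thin layer near the boundary gives initial states above and
  below it whose boundary values are the constants \<open>m\<close> and \<open>- m\<close>
  (\<open>upper_barrier\<close>). By comparison the solution is squeezed between the two solutions with constant
  boundary inputs, so their estimates bound it, and \<open>m\<close> can be sent to \<open>M\<close>. The estimate
  is uniform in the layer: the modified states are bounded by \<open>\<bar>x0\<bar> + m\<close>, and the extra \<open>m\<close> is absorbed in the gain.

  From constant boundary inputs to constant distributed inputs and back: subtracting the constant \<open>c\<close> turns
  a solution with boundary value \<open>c\<close> into a solution of the distributed problem with input \<open>c\<close>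
  (\<open>BI_DI_solution_translate\<close>), and changes all norms by at most a multiple of \<open>\<bar>c\<bar>\<close>.

  In all cases the old estimate has to be read off at enlarged arguments and multiplied by a factor;
  \<open>ISS_estimate_absorb\<close> does this once. Since constant factors are harmless there, the triangle inequality for
  the norms is proved only up to a factor (\<open>Lp_norm_quasi_triangle\<close>).
\<close>

section \<open>Second-order conditions at an interior maximum\<close>

lemma has_partial_imp_DERIV_line:
  assumes "has_partial i g (z + s *\<^sub>R axis i 1)"
  shows "((\<lambda>r. g (z + r *\<^sub>R axis i 1)) has_real_derivative partial i g (z + s *\<^sub>R axis i 1)) (at s)"
proof -
  have "((\<lambda>r. g (z + s *\<^sub>R axis i 1 + r *\<^sub>R axis i 1)) has_real_derivative
      partial i g (z + s *\<^sub>R axis i 1)) (at 0)"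
    using assms unfolding has_partial_def partial_def by (simp add: field_differentiable_derivI)
  moreover have "(\<lambda>r. g (z + s *\<^sub>R axis i 1 + r *\<^sub>R axis i 1)) = (\<lambda>r. g (z + (r + s) *\<^sub>R axis i 1))"
    by (simp add: algebra_simps)
  ultimately show ?thesis
    using DERIV_shift[of "\<lambda>r. g (z + r *\<^sub>R axis i 1)" _ 0 s] by simp
qed

text \<open>Partial derivatives only see values near the point. Stating the rule for a function that is a
  difference merely on \<open>G\<close> lets it be applied again to first partial derivatives, and to states
  extended by zero outside \<open>closure G\<close>.\<close>

lemma partial_diff_on_open:
  assumes "open G" "z \<in> G" and eq: "\<And>w. w \<in> G \<Longrightarrow> h w = g w - k w"
    and g: "has_partial i g z" and k: "has_partial i k z"
  shows "has_partial i h z" "partial i h z = partial i g z - partial i k z"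
proof -
  have D: "((\<lambda>s. g (z + s *\<^sub>R axis i 1) - k (z + s *\<^sub>R axis i 1)) has_real_derivative
      partial i g z - partial i k z) (at 0)"
    using has_partial_imp_DERIV_line[of i g z 0] has_partial_imp_DERIV_line[of i k z 0] g k
    by (intro DERIV_diff) simp_all
  have "((\<lambda>s. z + s *\<^sub>R axis i 1) \<longlongrightarrow> z + 0 *\<^sub>R axis i 1) (nhds (0::real))"
    by (intro tendsto_intros filterlim_ident)
  then have "\<forall>\<^sub>F s in nhds (0::real). z + s *\<^sub>R axis i 1 \<in> G"
    using \<open>open G\<close> \<open>z \<in> G\<close> by (auto dest: topological_tendstoD)
  then have "\<forall>\<^sub>F s in nhds 0. h (z + s *\<^sub>R axis i 1) = g (z + s *\<^sub>R axis i 1) - k (z + s *\<^sub>R axis i 1)"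
    by eventually_elim (simp add: eq)
  from DERIV_cong_ev[OF refl this refl] D
  have "((\<lambda>s. h (z + s *\<^sub>R axis i 1)) has_real_derivative partial i g z - partial i k z) (at 0)"
    by (rule iffD2)
  then show "has_partial i h z" "partial i h z = partial i g z - partial i k z"
    unfolding has_partial_def partial_def by (auto simp: field_differentiable_def DERIV_imp_deriv)
qed

definition C2_on :: "(real^'n::finite) set \<Rightarrow> (real^'n \<Rightarrow> real) \<Rightarrow> bool" where
  "C2_on G g \<longleftrightarrow>
     (\<forall>z\<in>G. (\<forall>i. has_partial i g z) \<and> (\<forall>i j. has_partial i (partial j g) z)) \<and>
     (\<forall>i. continuous_on G (partial i g)) \<and>
     (\<forall>i j. continuous_on G (partial i (partial j g)))"

lemma C2_on_diff:
  assumes "open G" and eq: "\<forall>w\<in>G. h w = g w - k w" and g: "C2_on G g" and k: "C2_on G k"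
  shows "C2_on G h"
    and "z \<in> G \<Longrightarrow> partial i h z = partial i g z - partial i k z"
    and "z \<in> G \<Longrightarrow> partial i (partial j h) z = partial i (partial j g) z - partial i (partial j k) z"
proof -
  have hp: "has_partial i g z" "has_partial i (partial j g) z" "has_partial i k z"
    "has_partial i (partial j k) z" if "z \<in> G" for z i j
    using g k that by (simp_all add: C2_on_def)
  have co: "continuous_on G (partial i g)" "continuous_on G (partial i (partial j g))"
    "continuous_on G (partial i k)" "continuous_on G (partial i (partial j k))" for i j
    using g k by (simp_all add: C2_on_def)
  have 1: "has_partial i h z \<and> partial i h z = partial i g z - partial i k z" if "z \<in> G" for z i
    using partial_diff_on_open[of G z h g k i, OF \<open>open G\<close> that] eq hp[OF that] by simp
  have 2: "has_partial i (partial j h) z \<and>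
      partial i (partial j h) z = partial i (partial j g) z - partial i (partial j k) z"
    if "z \<in> G" for z i j
    using partial_diff_on_open[of G z "partial j h" "partial j g" "partial j k" i, OF \<open>open G\<close> that]
      1 hp[OF that] by simp
  have "continuous_on G (partial i h)" for i
    by (rule continuous_on_eq[of _ "\<lambda>z. partial i g z - partial i k z"])
      (simp_all add: 1 co continuous_on_diff)
  moreover have "continuous_on G (partial i (partial j h))" for i j
    by (rule continuous_on_eq[of _ "\<lambda>z. partial i (partial j g) z - partial i (partial j k) z"])
      (simp_all add: 2 co continuous_on_diff)
  ultimately show "C2_on G h" by (simp add: C2_on_def 1 2)
  show "z \<in> G \<Longrightarrow> partial i h z = partial i g z - partial i k z" by (simp add: 1)
  show "z \<in> G \<Longrightarrow> partial i (partial j h) z = partial i (partial j g) z - partial i (partial j k) z"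
    by (simp add: 2)
qed

lemma partial_const:
  fixes i :: "'n::finite"
  shows "has_partial i (\<lambda>_. c) z" and "partial i (\<lambda>_. c) = (\<lambda>_. 0)"
  unfolding has_partial_def partial_def by simp_all

lemma C2_on_const:
  fixes G :: "(real^'n::finite) set"
  shows "C2_on G (\<lambda>_. c)"
  unfolding C2_on_def partial_const(2) by (intro conjI ballI allI partial_const(1) continuous_on_const)

text \<open>The increment is changed one coordinate at a time; by the mean value theorem each step contributes
  the corresponding partial derivative at a nearby point, which is close to its value at \<open>z\<close>. The
  induction is on the set \<open>S\<close> of coordinates already moved.\<close>

lemma continuous_partials_imp_has_derivative:
  fixes g :: "real^'n::finite \<Rightarrow> real"
  assumes "open G" "z \<in> G" and hp: "\<And>w i. w \<in> G \<Longrightarrow> has_partial i g w"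
    and cont: "\<And>i. continuous_on G (partial i g)"
  shows "(g has_derivative (\<lambda>h. \<Sum>i\<in>UNIV. h $ i * partial i g z)) (at z)"
proof -
  define part where "part S h = (\<Sum>i\<in>S. h $ i *\<^sub>R axis i (1::real))" for S :: "'n set" and h :: "real^'n"
  have comp: "part S h $ i = (if i \<in> S then h $ i else 0)" for S h i
    unfolding part_def by (simp add: axis_def sum.delta if_distrib cong: if_cong)
  have norm_part: "norm (part S h) \<le> norm h" for S h
    by (rule norm_le_componentwise_cart) (simp add: comp)
  have main: "\<forall>e>0. \<exists>d>0. \<forall>h. norm h < d \<longrightarrow>
     \<bar>g (z + part S h) - g z - (\<Sum>i\<in>S. h $ i * partial i g z)\<bar> \<le> e * norm h" for S
  proof (induction S rule: finite_induct[OF finite])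
    case 1
    show ?case by (auto intro!: exI[of _ 1] simp: part_def)
  next
    case (2 s S)
    show ?case
    proof (intro allI impI)
      fix e :: real assume "e > 0"
      then obtain d1 where d1: "d1 > 0" and D1: "\<And>h. norm h < d1 \<Longrightarrow>
          \<bar>g (z + part S h) - g z - (\<Sum>i\<in>S. h $ i * partial i g z)\<bar> \<le> e / 2 * norm h"
        using 2(3) half_gt_zero by blast
      obtain r where r: "r > 0" "ball z r \<subseteq> G" using assms(1,2) openE by blast
      obtain d2 where d2: "d2 > 0"
        and D2: "\<And>w. w \<in> G \<Longrightarrow> dist w z < d2 \<Longrightarrow> dist (partial s g w) (partial s g z) < e / 2"
        using cont[of s] \<open>e > 0\<close> \<open>z \<in> G\<close> unfolding continuous_on_iff by (meson half_gt_zero)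
      define d where "d = min d1 (min r d2)"
      have "\<bar>g (z + part (insert s S) h) - g z - (\<Sum>i\<in>insert s S. h $ i * partial i g z)\<bar>
          \<le> e * norm h" if h: "norm h < d" for h
      proof -
        define y where "y = z + part S h"
        have ins: "part (insert s S) h = part S h + h $ s *\<^sub>R axis s 1"
          using 2(1,2) by (simp add: part_def)
        have near: "norm (part S h + v *\<^sub>R axis s 1) \<le> norm h" if "\<bar>v\<bar> \<le> \<bar>h $ s\<bar>" for v
          by (rule norm_le_componentwise_cart) (use that 2(2) in \<open>auto simp: comp axis_def\<close>)
        have inG: "y + v *\<^sub>R axis s 1 \<in> G \<and> dist (y + v *\<^sub>R axis s 1) z < d2" if "\<bar>v\<bar> \<le> \<bar>h $ s\<bar>" for v
        proof -
          have "norm (part S h + v *\<^sub>R axis s 1) < d" using near[OF that] h by simp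
          then have "dist (y + v *\<^sub>R axis s 1) z < d"
            unfolding y_def dist_norm by (simp add: algebra_simps)
          then show ?thesis using r(2) unfolding d_def by (auto simp: dist_commute subset_iff)
        qed
        obtain v where v: "\<bar>v\<bar> \<le> \<bar>h $ s\<bar>"
          "g (y + (h $ s) *\<^sub>R axis s 1) - g y = h $ s * partial s g (y + v *\<^sub>R axis s 1)"
        proof (cases "h $ s = 0")
          case True then show ?thesis using that[of 0] by simp
        next
          case False
          define q where "q \<equiv> \<lambda>v. g (y + v *\<^sub>R axis s 1)"
          have DD: "(q has_real_derivative partial s g (y + v *\<^sub>R axis s 1)) (at v)" if "\<bar>v\<bar> \<le> \<bar>h $ s\<bar>" for v
            unfolding q_def by (rule has_partial_imp_DERIV_line) (use inG[OF that] hp in blast)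
          consider "h $ s > 0" | "h $ s < 0" using False by linarith
          then show ?thesis
          proof cases
            case 1
            obtain v where "0 < v" "v < h $ s" "q (h $ s) - q 0 = (h $ s - 0) * partial s g (y + v *\<^sub>R axis s 1)"
              using MVT2[of 0 "h $ s" q "\<lambda>v. partial s g (y + v *\<^sub>R axis s 1)"] 1 DD by auto
            then show ?thesis by (intro that[of v]) (auto simp: q_def)
          next
            case 2
            obtain v where "h $ s < v" "v < 0" "q 0 - q (h $ s) = (0 - h $ s) * partial s g (y + v *\<^sub>R axis s 1)"
              using MVT2[of "h $ s" 0 q "\<lambda>v. partial s g (y + v *\<^sub>R axis s 1)"] 2 DD by auto
            then show ?thesis by (intro that[of v]) (auto simp: q_def)
          qed
        qed
        have "\<bar>g (y + (h $ s) *\<^sub>R axis s 1) - g y - h $ s * partial s g z\<bar>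
            = \<bar>h $ s\<bar> * \<bar>partial s g (y + v *\<^sub>R axis s 1) - partial s g z\<bar>"
          by (simp add: v(2) abs_mult flip: right_diff_distrib)
        also have "\<dots> \<le> norm h * (e / 2)"
          using D2[of "y + v *\<^sub>R axis s 1"] inG[OF v(1)]
          by (intro mult_mono) (auto simp: component_le_norm_cart dist_real_def)
        finally have "\<bar>g (y + (h $ s) *\<^sub>R axis s 1) - g y - h $ s * partial s g z\<bar> \<le> e / 2 * norm h"
          by (simp add: mult.commute)
        moreover have "\<bar>g y - g z - (\<Sum>i\<in>S. h $ i * partial i g z)\<bar> \<le> e / 2 * norm h"
          unfolding y_def by (rule D1) (use h d_def in simp)
        moreover have "z + part (insert s S) h = y + (h $ s) *\<^sub>R axis s 1"
          by (simp add: ins y_def)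
        moreover have "(\<Sum>i\<in>insert s S. h $ i * partial i g z)
            = h $ s * partial s g z + (\<Sum>i\<in>S. h $ i * partial i g z)"
          using 2(1,2) by simp
        moreover have "g (y + (h $ s) *\<^sub>R axis s 1)  - g z - (h $ s * partial s g z + (\<Sum>i\<in>S. h $ i * partial i g z))
            = (g (y + (h $ s) *\<^sub>R axis s 1) - g y - h $ s * partial s g z)
              + (g y - g z - (\<Sum>i\<in>S. h $ i * partial i g z))" by simp
        ultimately show ?thesis by (smt (verit) field_sum_of_halves abs_triangle_ineq distrib_right)
      qed
      moreover have "d > 0" using d1 d2 r by (simp add: d_def)
      ultimately show "\<exists>d>0. \<forall>h. norm h < d \<longrightarrow>
        \<bar>g (z + part (insert s S) h) - g z - (\<Sum>i\<in>insert s S. h $ i * partial i g z)\<bar> \<le> e * norm h"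
        by blast
    qed
  qed
  have full: "part UNIV h = h" for h by (simp add: vec_eq_iff comp)
  have "bounded_linear (\<lambda>h::real^'n. \<Sum>i\<in>UNIV. h $ i * partial i g z)"
    by (intro bounded_linear_intros bounded_linear_compose[OF bounded_linear_mult_left] bounded_linear_vec_nth)
  then show ?thesis
    unfolding has_derivative_at_alt
  proof (intro conjI allI impI)
    fix e :: real assume "e > 0"
    with main[of UNIV] obtain d where d: "d > 0" "\<And>h. norm h < d \<Longrightarrow>
       \<bar>g (z + h) - g z - (\<Sum>i\<in>UNIV. h $ i * partial i g z)\<bar> \<le> e * norm h"
      unfolding full by blast
    have "norm (g y - g z - (\<Sum>i\<in>UNIV. (y - z) $ i * partial i g z)) \<le> e * norm (y - z)"
      if "norm (y - z) < d" for y
      using d(2)[OF that] by simp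
    then show "\<exists>d>0. \<forall>y. norm (y - z) < d \<longrightarrow>
        norm (g y - g z - (\<Sum>i\<in>UNIV. (y - z) $ i * partial i g z)) \<le> e * norm (y - z)"
      using d(1) by blast
  qed
qed

lemma DERIV_along_line:
  fixes g :: "real^'n::finite \<Rightarrow> real"
  assumes "open G" "z + s *\<^sub>R \<xi> \<in> G" "\<And>w i. w \<in> G \<Longrightarrow> has_partial i g w"
    and "\<And>i. continuous_on G (partial i g)"
  shows "((\<lambda>s. g (z + s *\<^sub>R \<xi>)) has_real_derivative (\<Sum>i\<in>UNIV. \<xi> $ i * partial i g (z + s *\<^sub>R \<xi>))) (at s)"
proof -
  have "((\<lambda>s. g (z + s *\<^sub>R \<xi>)) has_derivative
      (\<lambda>h. \<Sum>i\<in>UNIV. (h *\<^sub>R \<xi>) $ i * partial i g (z + s *\<^sub>R \<xi>))) (at s)"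
    by (rule has_derivative_compose[where g = g and f = "\<lambda>s. z + s *\<^sub>R \<xi>"])
      (auto intro!: derivative_eq_intros continuous_partials_imp_has_derivative[of G] assms)
  then show ?thesis
    by (rule has_derivative_imp_has_field_derivative)
      (simp add: sum_distrib_left mult_ac)
qed

lemma second_derivative_nonpos_at_max:
  fixes \<phi> \<phi>' :: "real \<Rightarrow> real"
  assumes "e > 0" and D: "\<And>s. \<bar>s\<bar> < e \<Longrightarrow> (\<phi> has_real_derivative \<phi>' s) (at s)"
    and D2: "(\<phi>' has_real_derivative l) (at 0)" and max: "\<And>s. \<bar>s\<bar> < e \<Longrightarrow> \<phi> s \<le> \<phi> 0"
  shows "l \<le> 0"
proof (rule ccontr)
  assume "\<not> l \<le> 0"
  then obtain d where d: "d > 0" "\<And>h. 0 < h \<Longrightarrow> h < d \<Longrightarrow> \<phi>' 0 < \<phi>' (0 + h)"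
    using DERIV_pos_inc_right[OF D2] by auto
  have "\<phi>' 0 = 0"
    by (rule DERIV_local_max[OF D, of 0 e]) (use \<open>e > 0\<close> max in auto)
  define s where "s = min d e / 2"
  have s: "0 < s" "s < d" "s < e" using \<open>e > 0\<close> \<open>d > 0\<close> by (auto simp: s_def)
  obtain v where "0 < v" "v < s" "\<phi> s - \<phi> 0 = (s - 0) * \<phi>' v"
    using MVT2[of 0 s \<phi> \<phi>'] s D by auto
  moreover have "\<phi>' v > 0" using d(2)[of v] \<open>0 < v\<close> \<open>v < s\<close> s \<open>\<phi>' 0 = 0\<close> by simp
  ultimately have "\<phi> s > \<phi> 0" using s by (smt (verit) mult_pos_pos)
  then show False using max[of s] s by simp
qed

lemma quadratic_form_nonpos_at_max:
  fixes g :: "real^'n::finite \<Rightarrow> real"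
  assumes "open G" "z \<in> G" and g: "C2_on G g" and max: "\<And>w. w \<in> G \<Longrightarrow> g w \<le> g z"
  shows "(\<Sum>i\<in>UNIV. \<Sum>j\<in>UNIV. \<xi> $ i * \<xi> $ j * partial i (partial j g) z) \<le> 0"
proof -
  have "((\<lambda>s. z + s *\<^sub>R \<xi>) \<longlongrightarrow> z + 0 *\<^sub>R \<xi>) (nhds (0::real))"
    by (intro tendsto_intros filterlim_ident)
  then have "\<forall>\<^sub>F s in nhds (0::real). z + s *\<^sub>R \<xi> \<in> G"
    using \<open>open G\<close> \<open>z \<in> G\<close> by (auto dest: topological_tendstoD)
  then obtain e where e: "e > 0" "\<And>s. \<bar>s\<bar> < e \<Longrightarrow> z + s *\<^sub>R \<xi> \<in> G"
    unfolding eventually_nhds_metric by (auto simp: dist_real_def)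
  have hp: "has_partial i g w" "has_partial i (partial j g) w" if "w \<in> G" for w i j
    using g that by (auto simp: C2_on_def)
  have co: "continuous_on G (partial i g)" "continuous_on G (partial i (partial j g))" for i j
    using g by (auto simp: C2_on_def)
  have "((\<lambda>s. \<Sum>j\<in>UNIV. \<xi> $ j * partial j g (z + s *\<^sub>R \<xi>)) has_real_derivative
      (\<Sum>j\<in>UNIV. \<xi> $ j * (\<Sum>i\<in>UNIV. \<xi> $ i * partial i (partial j g) (z + 0 *\<^sub>R \<xi>)))) (at 0)"
    by (intro DERIV_sum DERIV_cmult DERIV_along_line[OF \<open>open G\<close>])
      (use hp co \<open>z \<in> G\<close> in auto)
  then have "(\<Sum>j\<in>UNIV. \<xi> $ j * (\<Sum>i\<in>UNIV. \<xi> $ i * partial i (partial j g) (z + 0 *\<^sub>R \<xi>))) \<le> 0"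
    by (rule second_derivative_nonpos_at_max[OF e(1), rotated, where \<phi> = "\<lambda>s. g (z + s *\<^sub>R \<xi>)"])
      (use e(2) hp co max in \<open>auto intro!: DERIV_along_line[OF \<open>open G\<close>]\<close>)
  also have "(\<Sum>j\<in>UNIV. \<xi> $ j * (\<Sum>i\<in>UNIV. \<xi> $ i * partial i (partial j g) (z + 0 *\<^sub>R \<xi>)))
    = (\<Sum>j\<in>UNIV. \<Sum>i\<in>UNIV. \<xi> $ i * \<xi> $ j * partial i (partial j g) z)"
    by (simp add: sum_distrib_left mult_ac)
  finally show ?thesis by (subst sum.swap)
qed

text \<open>Two applications of the mean value theorem. The left-hand side of the conclusion is symmetric in
  \<open>i\<close> and \<open>j\<close>, which is why continuous mixed partial derivatives commute.\<close>

lemma second_difference_eq_mixed_partial: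
  fixes g :: "real^'n::finite \<Rightarrow> real"
  assumes "h > 0"
    and inG: "\<And>s r. 0 \<le> s \<Longrightarrow> s \<le> h \<Longrightarrow> 0 \<le> r \<Longrightarrow> r \<le> h \<Longrightarrow> z + s *\<^sub>R axis i 1 + r *\<^sub>R axis j 1 \<in> G"
    and hp: "\<And>w. w \<in> G \<Longrightarrow> has_partial j g w" "\<And>w. w \<in> G \<Longrightarrow> has_partial i (partial j g) w"
  obtains s r where "0 < s" "s < h" "0 < r" "r < h"
    "g (z + h *\<^sub>R axis i 1 + h *\<^sub>R axis j 1) - g (z + h *\<^sub>R axis i 1) - g (z + h *\<^sub>R axis j 1) + g z
      = h * h * partial i (partial j g) (z + s *\<^sub>R axis i 1 + r *\<^sub>R axis j 1)"
proof -
  define q where "q r = g (z + h *\<^sub>R axis i 1 + r *\<^sub>R axis j 1) - g (z + r *\<^sub>R axis j 1)" for r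
  have "(q has_real_derivative partial j g (z + h *\<^sub>R axis i 1 + r *\<^sub>R axis j 1)
      - partial j g (z + r *\<^sub>R axis j 1)) (at r)" if "0 \<le> r" "r \<le> h" for r
    unfolding q_def
    by (intro DERIV_diff has_partial_imp_DERIV_line hp)
      (use inG[of h r] inG[of 0 r] that \<open>h > 0\<close> in auto)
  then obtain r where r: "0 < r" "r < h" "q h - q 0 = (h - 0) *
      (partial j g (z + h *\<^sub>R axis i 1 + r *\<^sub>R axis j 1) - partial j g (z + r *\<^sub>R axis j 1))"
    using MVT2[of 0 h q "\<lambda>r. partial j g (z + h *\<^sub>R axis i 1 + r *\<^sub>R axis j 1)
      - partial j g (z + r *\<^sub>R axis j 1)"] \<open>h > 0\<close> by blast
  define y where "y = z + r *\<^sub>R axis j 1"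
  have "((\<lambda>s. partial j g (y + s *\<^sub>R axis i 1)) has_real_derivative
      partial i (partial j g) (y + s *\<^sub>R axis i 1)) (at s)" if "0 \<le> s" "s \<le> h" for s
    by (intro has_partial_imp_DERIV_line hp) (use inG[of s r] that r y_def in \<open>auto simp: algebra_simps\<close>)
  then obtain s where s: "0 < s" "s < h"
    "partial j g (y + h *\<^sub>R axis i 1) - partial j g (y + 0 *\<^sub>R axis i 1)
      = (h - 0) * partial i (partial j g) (y + s *\<^sub>R axis i 1)"
    using MVT2[of 0 h "\<lambda>s. partial j g (y + s *\<^sub>R axis i 1)"
      "\<lambda>s. partial i (partial j g) (y + s *\<^sub>R axis i 1)"] \<open>h > 0\<close> by blast
  show ?thesis
    by (rule that[of s r]) (use r s in \<open>simp_all add: q_def y_def algebra_simps\<close>)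
qed

text \<open>Schwarz's theorem. The coefficient matrix of the operator is not assumed symmetric, so without it
  the antisymmetric part of the coefficients could contribute at a maximum.\<close>

lemma mixed_partials_symmetric:
  fixes g :: "real^'n::finite \<Rightarrow> real"
  assumes "open G" "z \<in> G" and g: "C2_on G g"
  shows "partial i (partial j g) z = partial j (partial i g) z"
proof (rule ccontr)
  assume ne: "partial i (partial j g) z \<noteq> partial j (partial i g) z"
  define e where "e = \<bar>partial i (partial j g) z - partial j (partial i g) z\<bar> / 2"
  have "e > 0" using ne by (simp add: e_def)
  obtain \<rho> where \<rho>: "\<rho> > 0" "ball z \<rho> \<subseteq> G" using assms(1,2) openE by blast
  have co: "continuous_on G (partial i (partial j g))" for i j
    using g by (auto simp: C2_on_def)
  have "\<exists>d>0. \<forall>w\<in>G. dist w z < d \<longrightarrow> dist (partial i (partial j g) w) (partial i (partial j g) z) < e" for i j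
    using co[of i j] \<open>e > 0\<close> \<open>z \<in> G\<close> unfolding continuous_on_iff by blast
  from this[of i j] this[of j i] obtain d1 d2 where d1: "d1 > 0"
    "\<And>w. w \<in> G \<Longrightarrow> dist w z < d1 \<Longrightarrow> dist (partial i (partial j g) w) (partial i (partial j g) z) < e"
    and d2: "d2 > 0"
    "\<And>w. w \<in> G \<Longrightarrow> dist w z < d2 \<Longrightarrow> dist (partial j (partial i g) w) (partial j (partial i g) z) < e"
    by metis
  define d where "d = Min {\<rho>, d1, d2}"
  have d: "d > 0" "d \<le> \<rho>" "d \<le> d1" "d \<le> d2" using \<rho> d1 d2 by (auto simp: d_def)
  define h where "h = d / 3"
  have near: "dist (z + s *\<^sub>R axis k 1 + r *\<^sub>R axis l 1) z < d" 
    if "0 \<le> s" "s \<le> h" "0 \<le> r" "r \<le> h" for s r and k l :: 'n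
  proof -
    have "norm (s *\<^sub>R axis k (1::real) + r *\<^sub>R axis l 1) \<le> s + r"
      using norm_triangle_ineq[of "s *\<^sub>R axis k (1::real)" "r *\<^sub>R axis l 1"] that by simp
    also have "\<dots> < d" using that d(1) by (simp add: h_def)
    finally show ?thesis by (simp add: dist_norm algebra_simps)
  qed
  have inG: "z + s *\<^sub>R axis k 1 + r *\<^sub>R axis l 1 \<in> G" 
    if "0 \<le> s" "s \<le> h" "0 \<le> r" "r \<le> h" for s r and k l :: 'n
    using near[OF that, of k l] \<rho> d by (auto simp: dist_commute subset_iff)
  have h: "h > 0" using d by (simp add: h_def)
  have hp: "has_partial i g w" "has_partial i (partial j g) w" if "w \<in> G" for w i j
    using g that by (auto simp: C2_on_def)
  obtain s r where sr: "0 < s" "s < h" "0 < r" "r < h"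
    "g (z + h *\<^sub>R axis i 1 + h *\<^sub>R axis j 1) - g (z + h *\<^sub>R axis i 1) - g (z + h *\<^sub>R axis j 1) + g z
      = h * h * partial i (partial j g) (z + s *\<^sub>R axis i 1 + r *\<^sub>R axis j 1)"
    by (rule second_difference_eq_mixed_partial[OF h, where g = g and z = z and G = G and i = i and j = j])
      (use inG hp in auto)
  obtain s' r' where sr': "0 < s'" "s' < h" "0 < r'" "r' < h"
    "g (z + h *\<^sub>R axis j 1 + h *\<^sub>R axis i 1) - g (z + h *\<^sub>R axis j 1) - g (z + h *\<^sub>R axis i 1) + g z
      = h * h * partial j (partial i g) (z + s' *\<^sub>R axis j 1 + r' *\<^sub>R axis i 1)"
    by (rule second_difference_eq_mixed_partial[OF h, where g = g and z = z and G = G and i = j and j = i])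
      (use inG hp in auto)
  have "h * h * partial i (partial j g) (z + s *\<^sub>R axis i 1 + r *\<^sub>R axis j 1)
      = h * h * partial j (partial i g) (z + s' *\<^sub>R axis j 1 + r' *\<^sub>R axis i 1)"
    unfolding sr(5)[symmetric] sr'(5)[symmetric] by (simp add: algebra_simps)
  then have "partial i (partial j g) (z + s *\<^sub>R axis i 1 + r *\<^sub>R axis j 1)
      = partial j (partial i g) (z + s' *\<^sub>R axis j 1 + r' *\<^sub>R axis i 1)"
    using h by simp
  moreover have "dist (partial i (partial j g) (z + s *\<^sub>R axis i 1 + r *\<^sub>R axis j 1)) (partial i (partial j g) z) < e"
    by (rule d1(2)[OF inG]) (use sr d near[of s r i j] in auto)
  moreover have "dist (partial j (partial i g) (z + s' *\<^sub>R axis j 1 + r' *\<^sub>R axis i 1)) (partial j (partial i g) z) < e"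
    by (rule d2(2)[OF inG]) (use sr' d near[of s' r' j i] in auto)
  ultimately have "dist (partial i (partial j g) z) (partial j (partial i g) z) < 2 * e"
    using dist_triangle_half_r by (metis dist_commute dist_triangle_less_add mult_2)
  then show False unfolding dist_real_def e_def by simp
qed

text \<open>The trace of the product of a positive definite and a negative semidefinite matrix, by completing
  the square: subtracting from \<open>A\<close> the rank-one matrix \<open>A i s * A s j / A s s\<close> clears row and
  column \<open>s\<close> and leaves a positive definite Schur complement on the remaining indices, while the
  rank-one part contributes a value of the quadratic form of \<open>H\<close>.\<close>

lemma trace_nonpos_symmetric:
  fixes A H :: "'n \<Rightarrow> 'n \<Rightarrow> real"
  assumes "finite S"
    and "\<And>i j. A i j = A j i"
    and "\<And>\<xi>. (\<exists>i\<in>S. \<xi> i \<noteq> 0) \<Longrightarrow> (\<Sum>i\<in>S. \<Sum>j\<in>S. A i j * \<xi> i * \<xi> j) > 0"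
    and "\<And>\<xi>. (\<Sum>i\<in>S. \<Sum>j\<in>S. \<xi> i * \<xi> j * H i j) \<le> 0"
  shows "(\<Sum>i\<in>S. \<Sum>j\<in>S. A i j * H i j) \<le> 0"
  using assms
proof (induction S arbitrary: A rule: finite_induct)
  case (insert s S)
  have ins: "(\<Sum>i\<in>insert s S. \<Sum>j\<in>insert s S. F i j)
    = F s s + (\<Sum>j\<in>S. F s j) + (\<Sum>i\<in>S. F i s) + (\<Sum>i\<in>S. \<Sum>j\<in>S. F i j)" for F :: "'n \<Rightarrow> 'n \<Rightarrow> real"
    using insert.hyps by (simp add: sum.distrib algebra_simps)
  have ss: "A s s > 0"
  proof -
    have "0 < (\<Sum>i\<in>insert s S. \<Sum>j\<in>insert s S.
        A i j * (if i = s then 1 else 0) * (if j = s then 1 else 0))"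
      by (rule insert.prems(2)) auto
    also have "\<dots> = A s s" 
    proof -
      have "(\<Sum>j\<in>S. F j * (if j = s then 1 else 0)) = 0" for F :: "'n \<Rightarrow> real"
        by (rule sum.neutral) (use insert.hyps in auto)
      then show ?thesis unfolding ins by simp
    qed
    finally show ?thesis .
  qed
  define B where "B i j = A i j - A i s * A s j / A s s" for i j
  have "(\<Sum>i\<in>S. \<Sum>j\<in>S. B i j * H i j) \<le> 0"
  proof (rule insert.IH)
    show "B i j = B j i" for i j
      unfolding B_def using insert.prems(1)[of i j] insert.prems(1)[of i s] insert.prems(1)[of j s]
      by simp
  next
    fix \<xi> :: "'n \<Rightarrow> real" assume nz: "\<exists>i\<in>S. \<xi> i \<noteq> 0"
    \<comment> \<open>The value at \<open>s\<close> minimises the form of \<open>A\<close>; the minimum is the Schur complement form.\<close>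
    define c where "c = (\<Sum>j\<in>S. A s j * \<xi> j)"
    define \<eta> where "\<eta> = \<xi>(s := - c / A s s)"
    have \<eta>: "\<eta> s = - c / A s s" "\<And>i. i \<in> S \<Longrightarrow> \<eta> i = \<xi> i"
      using insert.hyps by (auto simp: \<eta>_def)
    have c': "(\<Sum>i\<in>S. A i s * \<xi> i) = c" unfolding c_def using insert.prems(1) by metis
    have "0 < (\<Sum>i\<in>insert s S. \<Sum>j\<in>insert s S. A i j * \<eta> i * \<eta> j)"
      by (rule insert.prems(2)) (use nz \<eta> in auto)
    also have "\<dots> = A s s * \<eta> s * \<eta> s + \<eta> s * c + c * \<eta> s + (\<Sum>i\<in>S. \<Sum>j\<in>S. A i j * \<xi> i * \<xi> j)"
      unfolding ins
    proof (intro arg_cong2[where f = "(+)"] refl)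
      show "(\<Sum>j\<in>S. A s j * \<eta> s * \<eta> j) = \<eta> s * c"
        unfolding c_def sum_distrib_left by (rule sum.cong) (auto simp: \<eta>(2))
      show "(\<Sum>i\<in>S. A i s * \<eta> i * \<eta> s) = c * \<eta> s"
        unfolding c'[symmetric] sum_distrib_right by (rule sum.cong) (auto simp: \<eta>(2))
      show "(\<Sum>i\<in>S. \<Sum>j\<in>S. A i j * \<eta> i * \<eta> j) = (\<Sum>i\<in>S. \<Sum>j\<in>S. A i j * \<xi> i * \<xi> j)"
        by (intro sum.cong) (auto simp: \<eta>(2))
    qed
    also have "A s s * \<eta> s * \<eta> s + \<eta> s * c + c * \<eta> s = - (c * c / A s s)"
      using ss by (simp add: \<eta>(1))
    also have "c * c / A s s = (\<Sum>i\<in>S. \<Sum>j\<in>S. A i s * A s j / A s s * \<xi> i * \<xi> j)"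
    proof -
      have "c * c / A s s = (\<Sum>i\<in>S. A i s * \<xi> i) * (\<Sum>j\<in>S. A s j * \<xi> j) / A s s"
        by (simp add: c' c_def)
      also have "\<dots> = (\<Sum>i\<in>S. \<Sum>j\<in>S. A i s * A s j / A s s * \<xi> i * \<xi> j)"
        unfolding sum_product sum_divide_distrib by (intro sum.cong) auto
      finally show ?thesis .
    qed
    also have "- (\<Sum>i\<in>S. \<Sum>j\<in>S. A i s * A s j / A s s * \<xi> i * \<xi> j) + (\<Sum>i\<in>S. \<Sum>j\<in>S. A i j * \<xi> i * \<xi> j)
        = (\<Sum>i\<in>S. \<Sum>j\<in>S. B i j * \<xi> i * \<xi> j)"
      unfolding B_def by (simp add: sum_subtractf[symmetric] left_diff_distrib)
    finally show "0 < (\<Sum>i\<in>S. \<Sum>j\<in>S. B i j * \<xi> i * \<xi> j)" .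
  next
    fix \<xi> :: "'n \<Rightarrow> real"
    have "(\<Sum>i\<in>insert s S. \<Sum>j\<in>insert s S. (\<xi>(s := 0)) i * (\<xi>(s := 0)) j * H i j) \<le> 0"
      by (rule insert.prems(3))
    moreover have "(\<Sum>i\<in>S. \<Sum>j\<in>S. (\<xi>(s := 0)) i * (\<xi>(s := 0)) j * H i j)
        = (\<Sum>i\<in>S. \<Sum>j\<in>S. \<xi> i * \<xi> j * H i j)"
      using insert.hyps by (intro sum.cong) auto
    ultimately show "(\<Sum>i\<in>S. \<Sum>j\<in>S. \<xi> i * \<xi> j * H i j) \<le> 0"
      unfolding ins by simp
  qed
  moreover have "(\<Sum>i\<in>insert s S. \<Sum>j\<in>insert s S. A i s * A s j * H i j) \<le> 0"
    using insert.prems(3)[of "\<lambda>i. A i s"] insert.prems(1)[of s] by simp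
  then have "(\<Sum>i\<in>insert s S. \<Sum>j\<in>insert s S. A i s * A s j / A s s * H i j) \<le> 0"
    using ss by (simp only: times_divide_eq_left sum_divide_distrib[symmetric] divide_nonpos_pos)
  moreover have "(\<Sum>i\<in>insert s S. \<Sum>j\<in>insert s S. A i j * H i j)
      = (\<Sum>i\<in>insert s S. \<Sum>j\<in>insert s S. A i s * A s j / A s s * H i j)
        + (\<Sum>i\<in>insert s S. \<Sum>j\<in>insert s S. B i j * H i j)"
    by (simp only: sum.distrib[symmetric]) (simp add: B_def algebra_simps)
  moreover have "(\<Sum>i\<in>insert s S. \<Sum>j\<in>insert s S. B i j * H i j) = (\<Sum>i\<in>S. \<Sum>j\<in>S. B i j * H i j)"
    unfolding ins using ss by (simp add: B_def)
  ultimately show ?case by linarith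
qed simp

lemma elliptic_operator_nonpos_at_max:
  fixes g :: "real^'n::finite \<Rightarrow> real" and A :: "'n \<Rightarrow> 'n \<Rightarrow> real"
  assumes "open G" "z \<in> G" and g: "C2_on G g" and max: "\<And>w. w \<in> G \<Longrightarrow> g w \<le> g z"
    and "K > 0"
    and A: "\<And>\<xi>::real^'n. (\<Sum>i\<in>UNIV. \<Sum>j\<in>UNIV. A i j * \<xi> $ i * \<xi> $ j) \<ge> K * (norm \<xi>)\<^sup>2"
  shows "(\<Sum>i\<in>UNIV. \<Sum>j\<in>UNIV. A i j * partial i (partial j g) z) \<le> 0"
proof -
  define H where "H i j = partial i (partial j g) z" for i j
  define B where "B i j = (A i j + A j i) / 2" for i j
  have sym: "H i j = H j i" for i j
    unfolding H_def by (rule mixed_partials_symmetric[OF assms(1-3)])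
  have symm_sum: "(\<Sum>i\<in>UNIV. \<Sum>j\<in>UNIV. B i j * F i j) = (\<Sum>i\<in>UNIV. \<Sum>j\<in>UNIV. A i j * F i j)"
    if "\<And>i j. F i j = F j i" for F
  proof -
    have "(\<Sum>i\<in>UNIV. \<Sum>j\<in>UNIV. B i j * F i j)
       = ((\<Sum>i\<in>UNIV. \<Sum>j\<in>UNIV. A i j * F i j) + (\<Sum>i\<in>UNIV. \<Sum>j\<in>UNIV. A j i * F i j)) / 2"
      by (simp only: sum.distrib[symmetric] sum_divide_distrib)
        (simp add: B_def algebra_simps add_divide_distrib)
    also have "(\<Sum>i\<in>UNIV. \<Sum>j\<in>UNIV. A j i * F i j) = (\<Sum>i\<in>UNIV. \<Sum>j\<in>UNIV. A i j * F i j)"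
      by (subst sum.swap) (simp add: that)
    finally show ?thesis by simp
  qed
  have "(\<Sum>i\<in>UNIV. \<Sum>j\<in>UNIV. B i j * H i j) \<le> 0"
  proof (rule trace_nonpos_symmetric)
    fix \<xi> :: "'n \<Rightarrow> real" assume "\<exists>i\<in>UNIV. \<xi> i \<noteq> 0"
    then have "(\<chi> i. \<xi> i) \<noteq> 0" by (auto simp: vec_eq_iff)
    then have "0 < K * (norm (\<chi> i. \<xi> i))\<^sup>2" using \<open>K > 0\<close> by simp
    also have "\<dots> \<le> (\<Sum>i\<in>UNIV. \<Sum>j\<in>UNIV. A i j * \<xi> i * \<xi> j)" using A[of "\<chi> i. \<xi> i"] by simp
    finally show "0 < (\<Sum>i\<in>UNIV. \<Sum>j\<in>UNIV. B i j * \<xi> i * \<xi> j)"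
      using symm_sum[of "\<lambda>i j. \<xi> i * \<xi> j"] by (simp add: mult_ac)
  next
    fix \<xi> :: "'n \<Rightarrow> real"
    show "(\<Sum>i\<in>UNIV. \<Sum>j\<in>UNIV. \<xi> i * \<xi> j * H i j) \<le> 0"
      using quadratic_form_nonpos_at_max[OF assms(1-4), of "\<chi> i. \<xi> i"] by (simp add: H_def)
  qed (auto simp: B_def)
  then show ?thesis using symm_sum[of H, OF sym] by (simp add: H_def)
qed

lemma partial_eq_0_at_max:
  assumes "open G" "z \<in> G" "has_partial i g z" and max: "\<And>w. w \<in> G \<Longrightarrow> g w \<le> g z"
  shows "partial i g z = 0"
proof -
  have "((\<lambda>s. z + s *\<^sub>R axis i 1) \<longlongrightarrow> z + 0 *\<^sub>R axis i 1) (nhds (0::real))"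
    by (intro tendsto_intros filterlim_ident)
  then have "\<forall>\<^sub>F s in nhds (0::real). z + s *\<^sub>R axis i 1 \<in> G"
    using \<open>open G\<close> \<open>z \<in> G\<close> by (auto dest: topological_tendstoD)
  then obtain e where e: "e > 0" "\<And>s. \<bar>s\<bar> < e \<Longrightarrow> z + s *\<^sub>R axis i 1 \<in> G"
    unfolding eventually_nhds_metric by (auto simp: dist_real_def)
  have "((\<lambda>r. g (z + r *\<^sub>R axis i 1)) has_real_derivative partial i g z) (at 0)"
    using has_partial_imp_DERIV_line[of i g z 0] assms(3) by simp
  then show ?thesis
    by (rule DERIV_local_max[OF _ e(1)]) (use e(2) max in auto)
qed

section \<open>The comparison principle\<close>

lemma C12_imp_C2_on_slice:
  fixes G :: "(real^'n::finite) set"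
  assumes "C12 G x" "t > 0"
  shows "C2_on G (x t)"
proof -
  have slice: "continuous_on G (F t)" if "continuous_on ({0<..} \<times> G) (\<lambda>(t, z). F t z)"
    for F :: "real \<Rightarrow> real^'n \<Rightarrow> real"
  proof -
    have "continuous_on G ((\<lambda>(t, z). F t z) \<circ> (\<lambda>z. (t, z)))"
      using assms(2) by (intro continuous_on_compose continuous_intros continuous_on_subset[OF that]) auto
    then show ?thesis by (simp add: o_def)
  qed
  show ?thesis
    using assms unfolding C12_def C2_on_def
    by (auto intro: slice[of "\<lambda>t z. partial _ (x t) z"] slice[of "\<lambda>t z. partial _ (partial _ (x t)) z"])
qed

lemma CL_continuous_on: "x \<in> CL G \<Longrightarrow> continuous_on ({0..} \<times> closure G) (\<lambda>(t, z). x t z)"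
  by (simp add: CL_def C0_time_def)

text \<open>The weight \<open>exp (- k t)\<close> turns the one-sided Lipschitz bound into a sign condition at a positive
  maximum, with \<open>k\<close> chosen for the range of both functions on the cylinder up to time \<open>T\<close>.\<close>

lemma comparison_principle:
  fixes G :: "(real^'n::finite) set"
  assumes setting: "parabolic_setting G a f" and "H2 G f"
    and x: "x \<in> CL G" "\<And>t z. t > 0 \<Longrightarrow> z \<in> G \<Longrightarrow> L_op a f x t z = 0"
    and y: "y \<in> CL G" "\<And>t z. t > 0 \<Longrightarrow> z \<in> G \<Longrightarrow> L_op a f y t z = 0"
    and init: "\<And>z. z \<in> G \<Longrightarrow> x 0 z \<le> y 0 z"
    and bdry: "\<And>t z. t \<ge> 0 \<Longrightarrow> z \<in> frontier G \<Longrightarrow> x t z \<le> y t z"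
    and "T \<ge> 0" "z \<in> closure G"
  shows "x T z \<le> y T z"
proof (rule ccontr)
  assume pos: "\<not> x T z \<le> y T z"
  have "open G" and "bounded G" using setting by (auto simp: parabolic_setting_def)
  have cl: "closure G = G \<union> frontier G" using closure_Un_frontier by blast
  define D where "D = {0..T} \<times> closure G"
  have DT: "(T, z) \<in> D" using \<open>T \<ge> 0\<close> \<open>z \<in> closure G\<close> by (simp add: D_def)
  have "compact D" unfolding D_def using \<open>bounded G\<close> by (intro compact_Times) (auto simp: compact_closure)
  have contx: "continuous_on D (\<lambda>(t, z). x t z)" and conty: "continuous_on D (\<lambda>(t, z). y t z)"
    using CL_continuous_on[OF x(1)] CL_continuous_on[OF y(1)]
    by (auto elim!: continuous_on_subset simp: D_def)
  define W where "W = (\<lambda>(t, z). x t z) ` D \<union> (\<lambda>(t, z). y t z) ` D"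
  have "bounded W" unfolding W_def
    using compact_continuous_image[OF contx \<open>compact D\<close>] compact_continuous_image[OF conty \<open>compact D\<close>]
    by (simp add: compact_imp_bounded)
  then obtain k where k: "\<And>w1 w2 z \<xi>. w1 \<in> W \<Longrightarrow> w2 \<in> W \<Longrightarrow> w1 > w2 \<Longrightarrow> z \<in> G \<Longrightarrow>
      f z w1 \<xi> - f z w2 \<xi> < k * (w1 - w2)"
    using \<open>H2 G f\<close> unfolding H2_def by metis
  define m where "m = (\<lambda>(t, z). exp (- k * t) * (x t z - y t z))"
  have "continuous_on D m"
    using contx conty unfolding m_def case_prod_beta by (intro continuous_intros)
  then obtain q where "q \<in> D" and qmax: "\<And>r. r \<in> D \<Longrightarrow> m r \<le> m q"
    using continuous_attains_sup[OF \<open>compact D\<close>, of m] DT by blast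
  obtain t0 z0 where q: "q = (t0, z0)" by (cases q)
  have t0: "0 \<le> t0" "t0 \<le> T" and z0: "z0 \<in> closure G" using \<open>q \<in> D\<close> by (auto simp: q D_def)
  have "0 < m (T, z)" using pos by (simp add: m_def)
  also have "\<dots> \<le> m q" using DT by (rule qmax)
  finally have gt: "x t0 z0 > y t0 z0" by (simp add: m_def q zero_less_mult_iff)
  have "z0 \<in> G" using gt bdry[OF t0(1), of z0] z0 cl by force
  then have "t0 > 0" using gt init[of z0] t0(1) by (cases "t0 = 0") auto
  have C12: "C12 G x" "C12 G y" using x(1) y(1) by (auto simp: CL_def)
  define g where "g = (\<lambda>z. x t0 z - y t0 z)"
  have gmax: "g w \<le> g z0" if "w \<in> G" for w
  proof -
    have "m (t0, w) \<le> m (t0, z0)" using qmax[of "(t0, w)"] that t0 cl by (simp add: q D_def)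
    then show ?thesis by (simp add: m_def g_def)
  qed
  have C2x: "C2_on G (x t0)" and C2y: "C2_on G (y t0)"
    using C12 \<open>t0 > 0\<close> by (auto intro: C12_imp_C2_on_slice)
  have C2g: "C2_on G g" and p1: "partial i g z0 = partial i (x t0) z0 - partial i (y t0) z0"
    and p2: "partial i (partial j g) z0 = partial i (partial j (x t0)) z0 - partial i (partial j (y t0)) z0" for i j
    using C2_on_diff(1)[OF \<open>open G\<close> _ C2x C2y, of g]
      C2_on_diff(2,3)[OF \<open>open G\<close> _ C2x C2y \<open>z0 \<in> G\<close>, of g] by (simp_all add: g_def)
  have "partial i g z0 = 0" for i
    by (rule partial_eq_0_at_max[OF \<open>open G\<close> \<open>z0 \<in> G\<close>]) (use C2g gmax \<open>z0 \<in> G\<close> in \<open>auto simp: C2_on_def\<close>)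
  then have grad: "grad (x t0) z0 = grad (y t0) z0" by (simp add: grad_def p1)
  obtain K where "K > 0" and K: "\<And>\<xi>::real^'n.
      (\<Sum>i\<in>UNIV. \<Sum>j\<in>UNIV. a i j z0 * (\<xi> $ i) * (\<xi> $ j)) \<ge> K * (norm \<xi>)\<^sup>2"
    using setting z0 unfolding parabolic_setting_def by blast
  have "(\<Sum>i\<in>UNIV. \<Sum>j\<in>UNIV. a i j z0 * partial i (partial j g) z0) \<le> 0"
    by (rule elliptic_operator_nonpos_at_max[OF \<open>open G\<close> \<open>z0 \<in> G\<close> C2g gmax \<open>K > 0\<close> K])
  then have ell: "(\<Sum>i\<in>UNIV. \<Sum>j\<in>UNIV. a i j z0 * partial i (partial j (x t0)) z0)
      \<le> (\<Sum>i\<in>UNIV. \<Sum>j\<in>UNIV. a i j z0 * partial i (partial j (y t0)) z0)"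
    by (simp add: p2 right_diff_distrib sum_subtractf)
  define xt where "xt = deriv (\<lambda>s. x s z0) t0"
  define yt where "yt = deriv (\<lambda>s. y s z0) t0"
  have Dx: "((\<lambda>s. x s z0) has_real_derivative xt) (at t0)"
    and Dy: "((\<lambda>s. y s z0) has_real_derivative yt) (at t0)"
    using C12 \<open>t0 > 0\<close> \<open>z0 \<in> G\<close> unfolding C12_def xt_def yt_def
    by (auto intro: field_differentiable_derivI)
  have Dm: "((\<lambda>s. m (s, z0)) has_real_derivative
      exp (- k * t0) * ((xt - yt) - k * (x t0 z0 - y t0 z0))) (at t0)"
    unfolding m_def by (auto intro!: derivative_eq_intros Dx Dy simp: algebra_simps)
  \<comment> \<open>The maximum may be attained at the final time, so only earlier times may be compared.\<close>
  have time: "(xt - yt) - k * (x t0 z0 - y t0 z0) \<ge> 0"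
  proof (rule ccontr)
    assume "\<not> ?thesis"
    then have "exp (- k * t0) * ((xt - yt) - k * (x t0 z0 - y t0 z0)) < 0"
      by (simp add: mult_less_0_iff)
    from DERIV_neg_dec_left[OF Dm this] obtain d where d: "d > 0"
      "\<And>h. 0 < h \<Longrightarrow> h < d \<Longrightarrow> m (t0, z0) < m (t0 - h, z0)" by blast
    define h where "h = min d t0 / 2"
    have h: "0 < h" "h < d" "h \<le> t0" using \<open>d > 0\<close> \<open>t0 > 0\<close> by (auto simp: h_def)
    have "m (t0 - h, z0) \<le> m (t0, z0)"
      using qmax[of "(t0 - h, z0)"] h t0 z0 by (simp add: q D_def)
    then show False using d(2)[of h] h by simp
  qed
  have W: "x t0 z0 \<in> W" "y t0 z0 \<in> W" using \<open>q \<in> D\<close> unfolding W_def q by force+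
  have "f z0 (x t0 z0) (grad (x t0) z0) - f z0 (y t0 z0) (grad (y t0) z0) < k * (x t0 z0 - y t0 z0)"
    unfolding grad by (rule k[OF W gt \<open>z0 \<in> G\<close>])
  moreover have "L_op a f x t0 z0 = 0" "L_op a f y t0 z0 = 0"
    using x(2) y(2) \<open>t0 > 0\<close> \<open>z0 \<in> G\<close> by auto
  ultimately show False using time ell unfolding L_op_def xt_def[symmetric] yt_def[symmetric] by linarith
qed

section \<open>Solution maps\<close>

lemma CL_eqI:
  assumes "x \<in> CL G" "y \<in> CL G" "\<And>t z. t \<ge> 0 \<Longrightarrow> z \<in> closure G \<Longrightarrow> x t z = y t z"
  shows "x = y"
proof -
  have "ext0_time (closure G) x = ext0_time (closure G) y"
    using assms(3) by (intro ext) (simp add: ext0_time_def)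
  then show ?thesis using assms(1,2) by (simp add: CL_def C0_time_def)
qed

lemma BI_solution_unique:
  assumes "parabolic_setting G a f" "H2 G f" "BI_solution G a f x0 u x" "BI_solution G a f x0 u y"
  shows "x = y"
proof (rule CL_eqI)
  show "x \<in> CL G" "y \<in> CL G" using assms(3,4) by (auto simp: BI_solution_def)
next
  fix t :: real and z assume tz: "t \<ge> 0" "z \<in> closure G"
  have le: "x t z \<le> y t z" if "BI_solution G a f x0 u x" "BI_solution G a f x0 u y" for x y
    by (rule comparison_principle[OF assms(1,2) _ _ _ _ _ _ tz])
      (use that in \<open>auto simp: BI_solution_def\<close>)
  show "x t z = y t z"
    using le[OF assms(3,4)] le[OF assms(4,3)] by simp
qed

lemma BI_flow_eq:
  assumes "parabolic_setting G a f" "H2 G f" "BI_solution G a f x0 u x"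
  shows "BI_flow G a f t x0 u = x t"
proof -
  have "(THE x. BI_solution G a f x0 u x) = x"
    using assms by (intro the_equality) (auto intro: BI_solution_unique)
  then show ?thesis by (simp add: BI_flow_def)
qed

text \<open>The extension by zero keeps the result in the class of solutions, whose members vanish off their domain.\<close>

definition translate_time :: "(real^'n::finite) set \<Rightarrow> real \<Rightarrow> (real \<Rightarrow> real^'n \<Rightarrow> real) \<Rightarrow> real \<Rightarrow> real^'n \<Rightarrow> real"
  where "translate_time G c x = ext0_time (closure G) (\<lambda>t z. x t z - c)"

lemma translate_time_apply: "t \<ge> 0 \<Longrightarrow> z \<in> closure G \<Longrightarrow> translate_time G c x t z = x t z - c"
  by (simp add: translate_time_def ext0_time_def)

lemma translate_time_derivatives:
  assumes "open G" "C12 G x" "t > 0" "z \<in> G"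
  shows "(\<lambda>s. translate_time G c x s z) field_differentiable (at t)"
    and "deriv (\<lambda>s. translate_time G c x s z) t = deriv (\<lambda>s. x s z) t"
    and "C2_on G (translate_time G c x t)"
    and "partial i (translate_time G c x t) z = partial i (x t) z"
    and "partial i (partial j (translate_time G c x t)) z = partial i (partial j (x t)) z"
proof -
  have sub: "w \<in> G \<Longrightarrow> w \<in> closure G" for w using closure_subset by blast
  have "((\<lambda>s. x s z - c) has_real_derivative deriv (\<lambda>s. x s z) t - 0) (at t)"
    using assms by (intro DERIV_diff DERIV_const field_differentiable_derivI) (auto simp: C12_def)
  moreover have "\<forall>\<^sub>F s in nhds t. translate_time G c x s z = x s z - c"
    using eventually_nhds_in_open[of "{0<..}" t] \<open>t > 0\<close>
    by (auto elim!: eventually_mono simp: translate_time_apply sub assms(4))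
  note DERIV_cong_ev[OF refl this refl]
  ultimately have D: "((\<lambda>s. translate_time G c x s z) has_real_derivative deriv (\<lambda>s. x s z) t) (at t)"
    by simp
  then show "(\<lambda>s. translate_time G c x s z) field_differentiable (at t)"
    "deriv (\<lambda>s. translate_time G c x s z) t = deriv (\<lambda>s. x s z) t"
    by (auto simp: field_differentiable_def DERIV_imp_deriv)
  have eq: "\<forall>w\<in>G. translate_time G c x t w = x t w - c"
    using \<open>t > 0\<close> by (simp add: translate_time_apply sub)
  note C2 = C2_on_diff[of G "translate_time G c x t" "x t" "\<lambda>_. c", OF \<open>open G\<close> eq
      C12_imp_C2_on_slice[OF assms(2,3)] C2_on_const]
  show "C2_on G (translate_time G c x t)" by (rule C2(1))
  show "partial i (translate_time G c x t) z = partial i (x t) z"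
    using C2(2)[OF assms(4)] by (simp add: partial_const)
  show "partial i (partial j (translate_time G c x t)) z = partial i (partial j (x t)) z"
    using C2(3)[OF assms(4)] by (simp add: partial_const)
qed

lemma translate_time_CL:
  fixes G :: "(real^'n::finite) set"
  assumes "open G" "x \<in> CL G"
  shows "translate_time G c x \<in> CL G"
proof -
  have C12: "C12 G x" using assms by (simp add: CL_def)
  note D = translate_time_derivatives[OF \<open>open G\<close> C12, where c = c]
  have cong: "continuous_on ({0<..} \<times> G) (\<lambda>(t, z). F t z)"
    if "continuous_on ({0<..} \<times> G) (\<lambda>(t, z). H t z)" "\<And>t z. t > 0 \<Longrightarrow> z \<in> G \<Longrightarrow> F t z = H t z"
    for F H :: "real \<Rightarrow> real^'n \<Rightarrow> real"
    by (rule continuous_on_eq[OF that(1)]) (auto simp: that(2))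
  have "C12 G (translate_time G c x)"
    unfolding C12_def
  proof (intro conjI allI impI ballI)
    fix i j
    show "continuous_on ({0<..} \<times> G) (\<lambda>(t, z). deriv (\<lambda>s. translate_time G c x s z) t)"
      by (rule cong[of "\<lambda>t z. deriv (\<lambda>s. x s z) t"]) (use C12 D(2) in \<open>auto simp: C12_def\<close>)
    show "continuous_on ({0<..} \<times> G) (\<lambda>(t, z). partial i (translate_time G c x t) z)"
      by (rule cong[of "\<lambda>t z. partial i (x t) z"]) (use C12 D(4) in \<open>auto simp: C12_def\<close>)
    show "continuous_on ({0<..} \<times> G) (\<lambda>(t, z). partial i (partial j (translate_time G c x t)) z)"
      by (rule cong[of "\<lambda>t z. partial i (partial j (x t)) z"]) (use C12 D(5) in \<open>auto simp: C12_def\<close>)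
  next
    fix t :: real and z i j assume tz: "t > 0" "z \<in> G"
    show "(\<lambda>s. translate_time G c x s z) field_differentiable at t" by (rule D(1)[OF tz])
    show "has_partial i (translate_time G c x t) z"
      "has_partial i (partial j (translate_time G c x t)) z"
      using D(3)[OF tz] tz(2) by (simp_all add: C2_on_def)
  qed
  moreover have "continuous_on ({0..} \<times> closure G) (\<lambda>(t, z). translate_time G c x t z)"
    by (rule continuous_on_eq[of _ "\<lambda>p. (case p of (t, z) \<Rightarrow> x t z) - c"])
      (auto intro!: continuous_intros CL_continuous_on[OF assms(2)] simp: translate_time_apply)
  moreover have "ext0_time (closure G) (translate_time G c x) = translate_time G c x"
    by (intro ext) (simp add: translate_time_def ext0_time_def)
  ultimately show ?thesis by (simp add: CL_def C0_time_def)
qed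

lemma BI_DI_solution_translate:
  assumes "open G" and v: "\<forall>t\<ge>0. \<forall>z\<in>closure G. v t z = c"
    and u: "\<forall>t\<ge>0. \<forall>z\<in>frontier G. u t z = c"
    and y0: "\<forall>z\<in>G. y0 z = x0 z - c"
  shows "BI_solution G a f x0 u x \<Longrightarrow> DI_solution G a f y0 v (translate_time G c x)"
    and "DI_solution G a f y0 v y \<Longrightarrow> BI_solution G a f x0 u (translate_time G (- c) y)"
proof -
  have sub: "z \<in> closure G" if "z \<in> G \<or> z \<in> frontier G" for z
    using that closure_Un_frontier by blast
  note [simp] = translate_time_apply sub v[rule_format] u[rule_format] y0[rule_format]
  {
    assume x: "BI_solution G a f x0 u x"
    have C: "C12 G x" "x \<in> CL G" using x by (auto simp: BI_solution_def CL_def)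
    note D = translate_time_derivatives[OF \<open>open G\<close> C(1), where c = c]
    have "grad (translate_time G c x t) z = grad (x t) z" if "t > 0" "z \<in> G" for t z
      using D(4)[OF that] by (simp add: grad_def)
    then show "DI_solution G a f y0 v (translate_time G c x)"
      using x translate_time_CL[OF \<open>open G\<close> C(2)]
      by (auto simp: BI_solution_def DI_solution_def L_op_def D(2,5))
  }
  {
    assume y: "DI_solution G a f y0 v y"
    have C: "C12 G y" "y \<in> CL G" using y by (auto simp: DI_solution_def CL_def)
    note D = translate_time_derivatives[OF \<open>open G\<close> C(1), where c = "- c"]
    have "grad (translate_time G (- c) y t) z = grad (y t) z" if "t > 0" "z \<in> G" for t z
      using D(4)[OF that] by (simp add: grad_def)
    then show "BI_solution G a f x0 u (translate_time G (- c) y)"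
      using y translate_time_CL[OF \<open>open G\<close> C(2), of "- c"]
      by (auto simp: BI_solution_def DI_solution_def L_op_def D(2,5))
  }
qed

lemma DI_flow_eq:
  assumes setting: "parabolic_setting G a f" "H2 G f"
    and v: "\<forall>t\<ge>0. \<forall>z\<in>closure G. v t z = c"
    and u: "\<forall>t\<ge>0. \<forall>z\<in>frontier G. u t z = c"
    and y0: "\<forall>z\<in>G. y0 z = x0 z - c"
    and x: "BI_solution G a f x0 u x"
  shows "DI_flow G a f t y0 v = translate_time G c x t"
proof -
  have "open G" using setting by (simp add: parabolic_setting_def)
  note tr = BI_DI_solution_translate[of G v c u y0 x0 a f, OF \<open>open G\<close> v u y0]
  have "y = translate_time G c x" if y: "DI_solution G a f y0 v y" for y
  proof (rule CL_eqI)
    show "y \<in> CL G" "translate_time G c x \<in> CL G"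
      using y tr(1)[OF x] by (auto simp: DI_solution_def)
  next
    fix t :: real and z assume tz: "t \<ge> 0" "z \<in> closure G"
    have "x = translate_time G (- c) y"
      by (rule BI_solution_unique[OF setting x tr(2)[OF y]])
    then show "y t z = translate_time G c x t z" using tz by (simp add: translate_time_apply)
  qed
  then have "(THE y. DI_solution G a f y0 v y) = translate_time G c x"
    using tr(1)[OF x] by (intro the_equality)
  then show ?thesis by (simp add: DI_flow_def)
qed

section \<open>The norms\<close>

lemma emeasure_open_nonzero:
  fixes G :: "(real^'n::finite) set"
  assumes "open G" "G \<noteq> {}"
  shows "emeasure (restrict_space lborel G) (space (restrict_space lborel G)) \<noteq> 0"
proof
  assume "emeasure (restrict_space lborel G) (space (restrict_space lborel G)) = 0"
  then have "emeasure lborel G = 0"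
    using \<open>open G\<close> by (simp add: space_restrict_space emeasure_restrict_space)
  then have "G \<in> null_sets lebesgue"
    using \<open>open G\<close> by (metis borel_open null_sets_completionI null_setsI sets_lborel)
  then show False
    using assms open_not_negligible negligible_iff_null_sets by blast
qed

text \<open>The norm converts an extended real to a real, which is harmless only because the essential
  supremum is finite (\<open>w\<close> is bounded) and nonnegative (\<open>G\<close> has positive measure).\<close>

lemma Lp_norm_infty:
  fixes G :: "(real^'n::finite) set" and w :: "real^'n \<Rightarrow> real"
  assumes G: "open G" "bounded G" "G \<noteq> {}" and w: "continuous_on (closure G) w"
  shows "(\<lambda>z. ereal \<bar>w z\<bar>) \<in> borel_measurable (restrict_space lborel G)"
    and "ereal (Lp_norm \<infinity> G w) = esssup (restrict_space lborel G) (\<lambda>z. ereal \<bar>w z\<bar>)"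
    and "0 \<le> Lp_norm \<infinity> G w"
proof -
  let ?M = "restrict_space lborel G"
  have sp: "space ?M = G" by (simp add: space_restrict_space)
  have "continuous_on G w" using w continuous_on_subset closure_subset by blast
  then have "w \<in> borel_measurable (restrict_space borel G)"
    by (rule borel_measurable_continuous_on_restrict)
  then have "w \<in> borel_measurable ?M"
    by (simp add: measurable_def sets_restrict_space space_restrict_space)
  then show meas: "(\<lambda>z. ereal \<bar>w z\<bar>) \<in> borel_measurable ?M" by measurable
  have "bounded (w ` closure G)"
    using G(2) w by (intro compact_imp_bounded compact_continuous_image) (auto simp: compact_closure)
  then obtain B where B: "\<And>z. z \<in> closure G \<Longrightarrow> \<bar>w z\<bar> \<le> B"
    unfolding bounded_iff by auto
  have le: "esssup ?M (\<lambda>z. ereal \<bar>w z\<bar>) \<le> ereal B"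
    by (rule esssup_I[OF meas]) (use B closure_subset[of G] in \<open>auto intro!: AE_I2 simp: sp subset_iff\<close>)
  have "esssup ?M (\<lambda>z. 0::ereal) \<le> esssup ?M (\<lambda>z. ereal \<bar>w z\<bar>)"
    by (rule esssup_mono) auto
  then have ge: "0 \<le> esssup ?M (\<lambda>z. ereal \<bar>w z\<bar>)"
    using esssup_const[OF emeasure_open_nonzero[OF G(1,3)], of "0::ereal"] by simp
  have "\<bar>esssup ?M (\<lambda>z. ereal \<bar>w z\<bar>)\<bar> \<noteq> \<infinity>" using le ge by auto
  then show "ereal (Lp_norm \<infinity> G w) = esssup ?M (\<lambda>z. ereal \<bar>w z\<bar>)"
    by (simp add: Lp_norm_def ereal_real)
  then show "0 \<le> Lp_norm \<infinity> G w" using ge by (metis ereal_less_eq(5))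
qed

lemma set_integrable_powr:
  fixes G :: "(real^'n::finite) set" and w :: "real^'n \<Rightarrow> real"
  assumes "open G" "bounded G" "continuous_on (closure G) w" "q > 0"
  shows "set_integrable lborel G (\<lambda>z. \<bar>w z\<bar> powr q)"
proof -
  have "continuous_on (closure G) (\<lambda>z. \<bar>w z\<bar> powr q)"
    using assms by (intro continuous_on_powr' continuous_intros) auto
  then have "set_integrable lborel (closure G) (\<lambda>z. \<bar>w z\<bar> powr q)"
    unfolding set_integrable_def using assms(2)
    by (intro borel_integrable_compact) (auto simp: compact_closure)
  then show ?thesis
    by (rule set_integrable_subset) (use assms(1) closure_subset in auto)
qed

lemma Lp_norm_nonneg:
  fixes G :: "(real^'n::finite) set"
  assumes "open G" "bounded G" "G \<noteq> {}" "continuous_on (closure G) w"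
  shows "0 \<le> Lp_norm p G w"
proof (cases "p = \<infinity>")
  case True then show ?thesis using Lp_norm_infty(3)[OF assms] by simp
qed (simp add: Lp_norm_def)

text \<open>From \<open>(s + t) powr q \<le> 2 powr q * (s powr q + t powr q)\<close> pointwise and
  \<open>(s + t) powr (1/q) \<le> 2 * (s powr (1/q) + t powr (1/q))\<close> for the integrals.\<close>

lemma Lp_norm_quasi_triangle:
  fixes G :: "(real^'n::finite) set"
  assumes G: "open G" "bounded G" "G \<noteq> {}" and "1 \<le> p"
    and w: "continuous_on (closure G) w" and a: "continuous_on (closure G) a"
    and b: "continuous_on (closure G) b"
    and le: "\<And>z. z \<in> G \<Longrightarrow> \<bar>w z\<bar> \<le> \<bar>a z\<bar> + \<bar>b z\<bar>"
  shows "Lp_norm p G w \<le> 4 * (Lp_norm p G a + Lp_norm p G b)"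
proof (cases "p = \<infinity>")
  case True
  let ?M = "restrict_space lborel G"
  let ?E = "\<lambda>w. esssup ?M (\<lambda>z. ereal \<bar>w z\<bar>)"
  have "ereal (Lp_norm p G w) = ?E w" unfolding True by (rule Lp_norm_infty(2)[OF G w])
  also have "\<dots> \<le> esssup ?M (\<lambda>z. ereal \<bar>a z\<bar> + ereal \<bar>b z\<bar>)"
    by (rule esssup_AE_mono[OF Lp_norm_infty(1)[OF G w]])
      (auto intro!: AE_I2 simp: space_restrict_space le)
  also have "\<dots> \<le> ?E a + ?E b" by (rule esssup_add)
  also have "\<dots> = ereal (Lp_norm p G a + Lp_norm p G b)"
    unfolding True plus_ereal.simps(1)[symmetric] by (simp only: Lp_norm_infty(2)[OF G] a b)
  finally have "Lp_norm p G w \<le> Lp_norm p G a + Lp_norm p G b" by simp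
  then show ?thesis using Lp_norm_nonneg[OF G a, of p] Lp_norm_nonneg[OF G b, of p] by simp
next
  case False
  then obtain q where p: "p = ereal q" and q: "q \<ge> 1" using \<open>1 \<le> p\<close> by (cases p) auto
  define I where "I w = (LINT z:G|lborel. \<bar>w z\<bar> powr q)" for w :: "real^'n \<Rightarrow> real"
  have N: "Lp_norm p G w = I w powr (1 / q)" for w by (simp add: Lp_norm_def p I_def)
  have pos: "I w \<ge> 0" for w unfolding I_def set_lebesgue_integral_def
    by (intro Bochner_Integration.integral_nonneg) auto
  note int = set_integrable_powr[OF G(1,2)]
  have pw: "\<bar>w z\<bar> powr q \<le> 2 powr q * (\<bar>a z\<bar> powr q + \<bar>b z\<bar> powr q)" if "z \<in> G" for z
  proof -
    have "\<bar>w z\<bar> powr q \<le> (2 * max \<bar>a z\<bar> \<bar>b z\<bar>) powr q"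
      using le[OF that] q by (intro powr_mono2) auto
    also have "\<dots> = 2 powr q * (max \<bar>a z\<bar> \<bar>b z\<bar>) powr q" by (simp add: powr_mult)
    also have "\<dots> \<le> 2 powr q * (\<bar>a z\<bar> powr q + \<bar>b z\<bar> powr q)"
      by (intro mult_left_mono) (auto simp: max_def)
    finally show ?thesis .
  qed
  have ia: "set_integrable lborel G (\<lambda>z. \<bar>a z\<bar> powr q)" and ib: "set_integrable lborel G (\<lambda>z. \<bar>b z\<bar> powr q)"
    using int a b q by auto
  have "I w \<le> (LINT z:G|lborel. 2 powr q * (\<bar>a z\<bar> powr q + \<bar>b z\<bar> powr q))"
    unfolding I_def
    by (rule set_integral_mono) (use int[OF w] q pw ia ib in \<open>auto intro!: set_integral_add\<close>)
  also have "\<dots> = 2 powr q * (I a + I b)"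
    unfolding I_def using set_integral_add(2)[OF ia ib] by simp
  finally have "I w \<le> 2 powr q * (I a + I b)" .
  also have "\<dots> \<le> 2 powr q * (2 * max (I a) (I b))" by (intro mult_left_mono) auto
  finally have "I w powr (1/q) \<le> (2 powr q * (2 * max (I a) (I b))) powr (1/q)"
    using pos q by (intro powr_mono2) auto
  also have "\<dots> = 2 * (2 powr (1/q) * (max (I a) (I b)) powr (1/q))"
    using q by (simp add: powr_mult powr_powr)
  also have "\<dots> \<le> 2 * (2 powr 1 * (I a powr (1/q) + I b powr (1/q)))"
    using q by (intro mult_left_mono mult_mono powr_mono) (auto simp: max_def)
  finally show ?thesis by (simp add: N)
qed

lemma Lp_norm_const:
  fixes G :: "(real^'n::finite) set"
  assumes G: "open G" "bounded G" "G \<noteq> {}" and "1 \<le> p"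
  shows "Lp_norm p G (ext0 (closure G) (\<lambda>_. c)) = Lp_norm p G (ext0 (closure G) (\<lambda>_. 1)) * \<bar>c\<bar>"
proof (cases "p = \<infinity>")
  case True
  have eq: "ereal (Lp_norm p G (ext0 (closure G) (\<lambda>_. c))) = ereal \<bar>c\<bar>" for c
  proof -
    have "continuous_on (closure G) (ext0 (closure G) (\<lambda>_. c))"
      by (rule continuous_on_eq[of _ "\<lambda>_. c"]) (auto simp: ext0_def)
    note M = Lp_norm_infty(1,2)[OF G this]
    have "ereal (Lp_norm p G (ext0 (closure G) (\<lambda>_. c))) = esssup (restrict_space lborel G) (\<lambda>_. ereal \<bar>c\<bar>)"
      unfolding True M(2)
      by (rule esssup_AE_cong[OF M(1) borel_measurable_const], rule AE_I2)
        (use closure_subset[of G] in \<open>simp add: space_restrict_space ext0_def subset_iff\<close>)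
    also have "\<dots> = ereal \<bar>c\<bar>" by (rule esssup_const[OF emeasure_open_nonzero[OF G(1,3)]])
    finally show ?thesis .
  qed
  then show ?thesis by simp
next
  case False
  then obtain q where p: "p = ereal q" and q: "q \<ge> 1" using \<open>1 \<le> p\<close> by (cases p) auto
  have "(LINT z:G|lborel. \<bar>ext0 (closure G) (\<lambda>_. c) z\<bar> powr q)
      = (LINT z:G|lborel. \<bar>c\<bar> powr q * \<bar>ext0 (closure G) (\<lambda>_. 1) z\<bar> powr q)"
    by (rule set_lebesgue_integral_cong) (use G(1) closure_subset in \<open>auto simp: ext0_def\<close>)
  then show ?thesis using q by (simp add: Lp_norm_def p powr_mult powr_powr)
qed

lemma sup_norm_time_const:
  assumes "S \<noteq> {}" "\<And>t z. t \<ge> 0 \<Longrightarrow> z \<in> S \<Longrightarrow> u t z = c"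
  shows "sup_norm_time S u = \<bar>c\<bar>"
proof -
  have "(\<lambda>(t, z). \<bar>u t z\<bar>) ` ({0..} \<times> S) = {\<bar>c\<bar>}"
  proof (intro equalityI subsetI)
    fix y assume "y \<in> {\<bar>c\<bar>}"
    moreover obtain z where "z \<in> S" using assms(1) by blast
    ultimately have "y = (\<lambda>(t, z). \<bar>u t z\<bar>) (0, z)" "(0::real, z) \<in> {0..} \<times> S"
      using assms(2) by simp_all
    then show "y \<in> (\<lambda>(t, z). \<bar>u t z\<bar>) ` ({0..} \<times> S)" by (rule image_eqI)
  qed (use assms(2) in auto)
  then show ?thesis by (simp add: sup_norm_time_def)
qed

lemma abs_le_sup_norm_time:
  assumes "u \<in> boundary_inputs G" "t \<ge> 0" "z \<in> frontier G"
  shows "\<bar>u t z\<bar> \<le> sup_norm_time (frontier G) u"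
proof -
  obtain M where "\<And>t z. t \<ge> 0 \<Longrightarrow> z \<in> frontier G \<Longrightarrow> \<bar>u t z\<bar> \<le> M"
    using assms(1) by (fastforce simp: boundary_inputs_def)
  then have "bdd_above ((\<lambda>(t, z). \<bar>u t z\<bar>) ` ({0..} \<times> frontier G))"
    by (intro bdd_aboveI[of _ M]) auto
  from cSUP_upper[OF _ this, of "(t, z)"] show ?thesis
    using assms(2,3) by (simp add: sup_norm_time_def)
qed

section \<open>Comparison functions\<close>

lemma class_K_D:
  assumes "\<gamma> \<in> class_K"
  shows "continuous_on {0..} \<gamma>" "\<gamma> 0 = 0"
    "0 \<le> r \<Longrightarrow> r < s \<Longrightarrow> \<gamma> r < \<gamma> s" "0 \<le> r \<Longrightarrow> r \<le> s \<Longrightarrow> \<gamma> r \<le> \<gamma> s" "0 \<le> r \<Longrightarrow> 0 \<le> \<gamma> r"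
proof -
  show "continuous_on {0..} \<gamma>" "\<gamma> 0 = 0" using assms by (auto simp: class_K_def)
  have less: "0 \<le> r \<Longrightarrow> r < s \<Longrightarrow> \<gamma> r < \<gamma> s" for r s
    using assms by (auto simp: class_K_def monotone_on_def)
  then have mono: "0 \<le> r \<Longrightarrow> r \<le> s \<Longrightarrow> \<gamma> r \<le> \<gamma> s" for r s
    by (cases "r = s") (auto intro: less_imp_le)
  show "0 \<le> r \<Longrightarrow> r < s \<Longrightarrow> \<gamma> r < \<gamma> s" "0 \<le> r \<Longrightarrow> r \<le> s \<Longrightarrow> \<gamma> r \<le> \<gamma> s"
    by (fact less mono)+
  show "0 \<le> r \<Longrightarrow> 0 \<le> \<gamma> r" using mono[of 0 r] \<open>\<gamma> 0 = 0\<close> by simp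
qed

text \<open>At \<open>r = 0\<close> a function of class \<open>KL\<close> is constant in time, so only weak monotonicity holds there.\<close>

lemma class_KL_D:
  assumes "\<beta> \<in> class_KL"
  shows "t \<ge> 0 \<Longrightarrow> (\<lambda>r. \<beta> r t) \<in> class_K"
    and "0 \<le> r \<Longrightarrow> 0 \<le> s \<Longrightarrow> s \<le> t \<Longrightarrow> \<beta> r t \<le> \<beta> r s"
proof -
  show K: "t \<ge> 0 \<Longrightarrow> (\<lambda>r. \<beta> r t) \<in> class_K" for t using assms by (auto simp: class_KL_def)
  assume *: "0 \<le> r" "0 \<le> s" "s \<le> t"
  show "\<beta> r t \<le> \<beta> r s"
  proof (cases "r = 0 \<or> s = t")
    case True
    then show ?thesis using class_K_D(2)[OF K[of s]] class_K_D(2)[OF K[of t]] * by auto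
  next
    case False
    then have "\<beta> r t < \<beta> r s" using assms * by (auto simp: class_KL_def monotone_on_def)
    then show ?thesis by simp
  qed
qed

lemma class_KL_scale:
  assumes "\<beta> \<in> class_KL" "A > 0" "B > 0"
  shows "(\<lambda>r t. A * \<beta> (B * r) t) \<in> class_KL"
proof -
  have cont: "continuous_on ({0..} \<times> {0..}) (\<lambda>(r, t). \<beta> r t)"
    using assms(1) by (simp add: class_KL_def)
  have "continuous_on ({0..} \<times> {0..}) ((\<lambda>(r, t). \<beta> r t) \<circ> (\<lambda>(r, t). (B * r, t)))"
    unfolding case_prod_beta using assms(3) cont[unfolded case_prod_beta]
    by (intro continuous_on_compose continuous_intros) (auto elim!: continuous_on_subset)
  then have 1: "continuous_on ({0..} \<times> {0..}) (\<lambda>(r, t). A * \<beta> (B * r) t)"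
    by (auto simp: o_def case_prod_beta intro!: continuous_intros)
  have 2: "(\<lambda>r. A * \<beta> (B * r) t) \<in> class_K" if "t \<ge> 0" for t
  proof -
    note K = class_K_D[OF class_KL_D(1)[OF assms(1) that]]
    have "continuous_on {0..} ((\<lambda>r. \<beta> r t) \<circ> (\<lambda>r. B * r))"
      using assms(3) by (intro continuous_on_compose continuous_intros continuous_on_subset[OF K(1)]) auto
    then show ?thesis
      unfolding class_K_def monotone_on_def using K(2,3) assms(2,3)
      by (auto simp: o_def intro!: continuous_intros)
  qed
  have 3: "strict_antimono_on {0..} (\<lambda>t. A * \<beta> (B * r) t)" "((\<lambda>t. A * \<beta> (B * r) t) \<longlongrightarrow> 0) at_top"
    if "r > 0" for r
  proof -
    have "B * r > 0" using that assms(3) by simp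
    then have "strict_antimono_on {0..} (\<beta> (B * r))" "(\<beta> (B * r) \<longlongrightarrow> 0) at_top"
      using assms(1) by (auto simp: class_KL_def)
    then show "strict_antimono_on {0..} (\<lambda>t. A * \<beta> (B * r) t)" "((\<lambda>t. A * \<beta> (B * r) t) \<longlongrightarrow> 0) at_top"
      using assms(2) by (auto simp: monotone_on_def intro: tendsto_mult_right_zero)
  qed
  show ?thesis unfolding class_KL_def using 1 2 3 by blast
qed

text \<open>Either \<open>C * m \<le> r\<close> or \<open>r \<le> C * m\<close>, so \<open>\<beta>\<close> at the sum is bounded by its value at
  \<open>2 * A * r\<close> plus its value at \<open>2 * A * C * m\<close>; the latter is largest at time \<open>0\<close> and joins the gain.\<close>

lemma ISS_estimate_absorb:
  assumes \<beta>: "\<beta> \<in> class_KL" and \<gamma>: "\<gamma> \<in> class_K" and A: "A > 0" and C: "C \<ge> 0"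
  obtains \<beta>' \<gamma>' where "\<beta>' \<in> class_KL" "\<gamma>' \<in> class_K"
    "\<And>r m t. r \<ge> 0 \<Longrightarrow> m \<ge> 0 \<Longrightarrow> t \<ge> 0 \<Longrightarrow>
      A * (\<beta> (A * (r + C * m)) t + \<gamma> m + C * m) \<le> \<beta>' r t + \<gamma>' m"
proof (rule that)
  show "(\<lambda>r t. A * \<beta> (2 * A * r) t) \<in> class_KL" using class_KL_scale[OF \<beta> A, of "2 * A"] A by simp
  note K = class_K_D[OF class_KL_D(1)[OF \<beta> order_refl]] and G = class_K_D[OF \<gamma>]
  have "continuous_on {0..} ((\<lambda>r. \<beta> r 0) \<circ> (\<lambda>m. 2 * A * C * m))"
    using A C by (intro continuous_on_compose continuous_intros continuous_on_subset[OF K(1)]) auto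
  then have "continuous_on {0..} (\<lambda>m. A * (\<beta> (2 * A * C * m) 0 + \<gamma> m + C * m))"
    unfolding o_def by (intro continuous_intros G(1))
  moreover have "A * (\<beta> (2 * A * C * r) 0 + \<gamma> r + C * r) < A * (\<beta> (2 * A * C * s) 0 + \<gamma> s + C * s)"
    if "0 \<le> r" "r < s" for r s
  proof -
    have "\<beta> (2 * A * C * r) 0 \<le> \<beta> (2 * A * C * s) 0"
      using A C that by (intro K(4)) (auto intro: mult_left_mono)
    moreover have "\<gamma> r < \<gamma> s" using G(3) that by simp
    moreover have "C * r \<le> C * s" using C that by (simp add: mult_left_mono)
    ultimately show ?thesis using A by (intro mult_strict_left_mono) linarith+
  qed
  ultimately show "(\<lambda>m. A * (\<beta> (2 * A * C * m) 0 + \<gamma> m + C * m)) \<in> class_K"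
    using K(2) G(2) by (auto simp: class_K_def monotone_on_def)
  fix r m t :: real assume *: "r \<ge> 0" "m \<ge> 0" "t \<ge> 0"
  note Kt = class_K_D[OF class_KL_D(1)[OF \<beta> \<open>t \<ge> 0\<close>]]
  have Cm: "0 \<le> C * m" using C * by simp
  have "\<beta> (A * (r + C * m)) t \<le> \<beta> (2 * A * r) t + \<beta> (2 * A * C * m) t"
  proof (cases "C * m \<le> r")
    case True
    then have "\<beta> (A * (r + C * m)) t \<le> \<beta> (2 * A * r) t"
      using A * Cm by (intro Kt(4)) (auto simp: mult.assoc mult_left_mono)
    then show ?thesis using Kt(5)[of "2 * A * C * m"] A C * by simp
  next
    case False
    then have "A * (r + C * m) \<le> A * (2 * (C * m))" using A by (intro mult_left_mono) auto
    then have "\<beta> (A * (r + C * m)) t \<le> \<beta> (2 * A * C * m) t"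
      using A * Cm by (intro Kt(4)) (auto simp: mult_ac)
    then show ?thesis using Kt(5)[of "2 * A * r"] A * by simp
  qed
  also have "\<beta> (2 * A * C * m) t \<le> \<beta> (2 * A * C * m) 0"
    using A C * by (intro class_KL_D(2)[OF \<beta>]) auto
  finally have "A * (\<beta> (A * (r + C * m)) t + \<gamma> m + C * m)
      \<le> A * (\<beta> (2 * A * r) t + \<beta> (2 * A * C * m) 0 + \<gamma> m + C * m)"
    using A by (intro mult_left_mono) auto
  then show "A * (\<beta> (A * (r + C * m)) t + \<gamma> m + C * m)
      \<le> A * \<beta> (2 * A * r) t + A * (\<beta> (2 * A * C * m) 0 + \<gamma> m + C * m)"
    by (simp add: algebra_simps)
qed

lemma class_K_le_limit:
  assumes "\<gamma> \<in> class_K" "M \<ge> 0" and le: "\<And>m. m > M \<Longrightarrow> c \<le> \<gamma> m"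
  shows "c \<le> \<gamma> M"
proof -
  have "(\<gamma> \<longlongrightarrow> \<gamma> M) (at M within {0..})"
    using class_K_D(1)[OF assms(1)] assms(2) by (simp add: continuous_on_def)
  then have "(\<gamma> \<longlongrightarrow> \<gamma> M) (at_right M)"
    by (rule tendsto_mono[rotated]) (use assms(2) in \<open>auto intro!: at_le\<close>)
  then show ?thesis
    by (rule tendsto_lowerbound) (auto simp: eventually_at_right_less le eventually_at_filter)
qed

section \<open>Equivalence of the stability properties\<close>

locale boundary_control_system =
  fixes G :: "(real^'n::finite) set"
    and a :: "'n \<Rightarrow> 'n \<Rightarrow> real^'n \<Rightarrow> real"
    and f :: "real^'n \<Rightarrow> real \<Rightarrow> real^'n \<Rightarrow> real"
    and X :: "(real^'n \<Rightarrow> real) set"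
    and Uad :: "(real^'n \<Rightarrow> real) \<Rightarrow> (real \<Rightarrow> real^'n \<Rightarrow> real) set"
    and p :: ereal
  assumes setting: "parabolic_setting G a f" and H1: "H1 G a f X Uad" and H2: "H2 G f"
    and H3: "H3 G X" and p: "1 \<le> p"
begin

lemma G: "open G" "bounded G" "G \<noteq> {}"
  using setting by (auto simp: parabolic_setting_def)

lemma frontier_nonempty: "frontier G \<noteq> {}"
  using G by (metis frontier_eq_empty not_bounded_UNIV)

lemma in_closure: "z \<in> G \<Longrightarrow> z \<in> closure G" "z \<in> frontier G \<Longrightarrow> z \<in> closure G"
  using closure_Un_frontier by blast+

abbreviation N where "N \<equiv> Lp_norm p G"

abbreviation const where "const c \<equiv> ext0 (closure G) (\<lambda>_. c)"

definition C where "C = N (const 1)"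

lemma X_add: "x \<in> X \<Longrightarrow> y \<in> X \<Longrightarrow> (\<lambda>z. x z + y z) \<in> X"
  and X_cmult: "x \<in> X \<Longrightarrow> (\<lambda>z. c * x z) \<in> X"
  and X_const: "const c \<in> X"
  using H1 by (auto simp: H1_def)

lemma X_continuous: "x \<in> X \<Longrightarrow> continuous_on (closure G) x"
  using H1 by (auto simp: H1_def C0_def)

lemma Uad_boundary: "x0 \<in> X \<Longrightarrow> u \<in> Uad x0 \<Longrightarrow>
    u \<in> boundary_inputs G \<and> (\<forall>z\<in>frontier G. u 0 z = x0 z)"
  using H1 unfolding H1_def by blast

lemma solution_exists: "x0 \<in> X \<Longrightarrow> u \<in> Uad x0 \<Longrightarrow> \<exists>x. BI_solution G a f x0 u x"
  using H1 unfolding H1_def by meson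

lemmas flow_eq = BI_flow_eq[OF setting H2]

lemma C_nonneg: "C \<ge> 0"
  unfolding C_def by (intro Lp_norm_nonneg G X_continuous X_const)

lemma N_const: "N (const c) = C * \<bar>c\<bar>"
  unfolding C_def by (intro Lp_norm_const G p)

lemmas N_triangle = Lp_norm_quasi_triangle[OF G p]

lemma N_le_add_const:
  assumes "continuous_on (closure G) w" "continuous_on (closure G) x"
    and "\<And>z. z \<in> G \<Longrightarrow> \<bar>w z\<bar> \<le> \<bar>x z\<bar> + \<bar>c\<bar>"
  shows "N w \<le> 4 * (N x + C * \<bar>c\<bar>)"
  unfolding N_const[symmetric]
  by (rule N_triangle[OF assms(1,2) X_continuous[OF X_const]])
    (use assms(3) in \<open>simp add: ext0_def in_closure(1)\<close>)

lemma slice_continuous: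
  assumes "x \<in> CL G" "t \<ge> 0"
  shows "continuous_on (closure G) (x t)"
proof -
  have "continuous_on (closure G) ((\<lambda>(t, z). x t z) \<circ> (\<lambda>z. (t, z)))"
    using assms(2)
    by (intro continuous_on_compose continuous_intros continuous_on_subset[OF CL_continuous_on[OF assms(1)]]) auto
  then show ?thesis by (simp add: o_def)
qed

lemma BI_solution_CL: "BI_solution G a f x0 u x \<Longrightarrow> x \<in> CL G"
  by (simp add: BI_solution_def)

lemma constant_input:
  assumes "x0 \<in> X" "\<forall>z\<in>frontier G. x0 z = c"
  defines "u \<equiv> ext0_time (frontier G) (\<lambda>_. x0)"
  shows "u \<in> Uad x0 \<inter> const_boundary_inputs G" "\<forall>t\<ge>0. \<forall>z\<in>frontier G. u t z = c"
    "sup_norm_time (frontier G) u = \<bar>c\<bar>"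
proof -
  show u: "\<forall>t\<ge>0. \<forall>z\<in>frontier G. u t z = c" using assms by (simp add: ext0_time_def)
  then show "sup_norm_time (frontier G) u = \<bar>c\<bar>" using frontier_nonempty by (intro sup_norm_time_const) auto
  have "u \<in> Uad x0" using H1 assms unfolding H1_def by blast
  moreover from this have "u \<in> const_boundary_inputs G"
    using Uad_boundary[OF assms(1)] u unfolding const_boundary_inputs_def by blast
  ultimately show "u \<in> Uad x0 \<inter> const_boundary_inputs G" by blast
qed

text \<open>The points of \<open>closure G\<close> where \<open>x0 \<ge> c\<close> form a compact set away from the boundary. Interpolating
  between \<open>x0\<close> and \<open>c\<close> in a boundary layer that misses this set can therefore only raise the function.\<close>

lemma upper_barrier:
  assumes "x0 \<in> X" and lt: "\<And>z. z \<in> frontier G \<Longrightarrow> x0 z < c"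
  shows "\<exists>w\<in>X. (\<forall>z\<in>frontier G. w z = c) \<and> (\<forall>z\<in>G. x0 z \<le> w z \<and> \<bar>w z\<bar> \<le> \<bar>x0 z\<bar> + \<bar>c\<bar>)"
proof -
  define S where "S = {z \<in> closure G. c \<le> x0 z}"
  have "S = closure G \<inter> x0 -` {c..}" by (auto simp: S_def)
  then have "closed S" using continuous_closed_preimage[OF X_continuous[OF assms(1)]] by simp
  moreover have "bounded S" using G(2) by (rule bounded_subset[OF bounded_closure]) (auto simp: S_def)
  ultimately have "compact S" by (simp add: compact_eq_bounded_closed)
  moreover have "S \<inter> frontier G = {}" using lt by (force simp: S_def)
  ultimately obtain \<delta> where "\<delta> > 0" and \<delta>: "\<And>z y. z \<in> S \<Longrightarrow> y \<in> frontier G \<Longrightarrow> \<delta> \<le> dist z y"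
    using separate_compact_closed[of S "frontier G"] by auto
  from H3 \<open>\<delta> > 0\<close> assms(1) have "\<exists>k. continuous_on (closure G) k \<and> (\<forall>z\<in>closure G. k z \<in> {0..1}) \<and>
      (\<forall>z\<in>frontier G. k z = 1) \<and> (\<forall>z\<in>G. infdist z (frontier G) \<ge> \<delta> \<longrightarrow> k z = 0) \<and>
      ext0 (closure G) (\<lambda>z. (1 - k z) * x0 z + c * k z) \<in> X"
    unfolding H3_def by (elim allE[of _ \<delta>] impE allE[of _ c] ballE[of _ _ x0]) simp_all
  then obtain k where k': "\<forall>z\<in>closure G. k z \<in> {0..1}" "\<forall>z\<in>frontier G. k z = 1"
    "\<forall>z\<in>G. infdist z (frontier G) \<ge> \<delta> \<longrightarrow> k z = 0"
    and X: "ext0 (closure G) (\<lambda>z. (1 - k z) * x0 z + c * k z) \<in> X"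
    by blast
  then have k: "\<And>z. z \<in> closure G \<Longrightarrow> 0 \<le> k z \<and> k z \<le> 1" "\<And>z. z \<in> frontier G \<Longrightarrow> k z = 1"
    "\<And>z. z \<in> G \<Longrightarrow> infdist z (frontier G) \<ge> \<delta> \<Longrightarrow> k z = 0"
    by auto
  define w where "w = ext0 (closure G) (\<lambda>z. (1 - k z) * x0 z + c * k z)"
  have w: "w z = (1 - k z) * x0 z + c * k z" if "z \<in> closure G" for z
    using that by (simp add: w_def ext0_def)
  show ?thesis
  proof (intro bexI conjI ballI)
    show "w \<in> X" using X by (simp add: w_def)
    show "w z = c" if "z \<in> frontier G" for z using w k(2) in_closure that by simp
  next
    fix z assume z: "z \<in> G"
    show "x0 z \<le> w z"
    proof (cases "c \<le> x0 z")
      case True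
      then have "z \<in> S" using z in_closure by (simp add: S_def)
      then have "infdist z (frontier G) \<ge> \<delta>"
        using \<delta> frontier_nonempty unfolding infdist_def by (auto intro!: cINF_greatest)
      then show ?thesis using k(3) z w in_closure by simp
    next
      case False
      then have "0 \<le> k z * (c - x0 z)" using k(1) z in_closure by simp
      then show ?thesis using w[of z] z in_closure(1) by (simp add: algebra_simps)
    qed
    have "\<bar>w z\<bar> \<le> \<bar>(1 - k z) * x0 z\<bar> + \<bar>c * k z\<bar>" using w z in_closure by simp
    also have "\<dots> \<le> 1 * \<bar>x0 z\<bar> + \<bar>c\<bar> * 1"
      unfolding abs_mult using k(1)[of z] z in_closure by (intro add_mono mult_mono) auto
    finally show "\<bar>w z\<bar> \<le> \<bar>x0 z\<bar> + \<bar>c\<bar>" by simp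
  qed
qed

text \<open>The level \<open>m\<close> of the barriers must exceed \<open>M\<close> strictly, since the layer is found only if
  \<open>x0 < m\<close> on the boundary; continuity of the gain removes the excess.\<close>

lemma BI_ISS_const_imp_BI_ISS:
  assumes "BI_ISS p G a f X Uad (const_boundary_inputs G)"
  shows "BI_ISS p G a f X Uad (boundary_inputs G)"
proof -
  obtain \<beta> \<gamma> where \<beta>: "\<beta> \<in> class_KL" and \<gamma>: "\<gamma> \<in> class_K"
    and bound: "\<And>x u t. x \<in> X \<Longrightarrow> u \<in> Uad x \<inter> const_boundary_inputs G \<Longrightarrow> t \<ge> 0 \<Longrightarrow>
      N (BI_flow G a f t x u) \<le> \<beta> (N x) t + \<gamma> (sup_norm_time (frontier G) u)"
    using assms unfolding BI_ISS_def ISS_def by blast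
  obtain \<beta>' \<gamma>' where \<beta>': "\<beta>' \<in> class_KL" and \<gamma>': "\<gamma>' \<in> class_K"
    and absorb: "\<And>r m t. r \<ge> 0 \<Longrightarrow> m \<ge> 0 \<Longrightarrow> t \<ge> 0 \<Longrightarrow>
      8 * (\<beta> (8 * (r + C * m)) t + \<gamma> m + C * m) \<le> \<beta>' r t + \<gamma>' m"
    using ISS_estimate_absorb[OF \<beta> \<gamma> _ C_nonneg, of 8] by auto
  have "N (BI_flow G a f t x0 u) \<le> \<beta>' (N x0) t + \<gamma>' (sup_norm_time (frontier G) u)"
    if x0: "x0 \<in> X" and u: "u \<in> Uad x0 \<inter> boundary_inputs G" and t: "t \<ge> 0" for x0 u t
  proof -
    define M where "M = sup_norm_time (frontier G) u"
    have M: "\<And>t z. t \<ge> 0 \<Longrightarrow> z \<in> frontier G \<Longrightarrow> \<bar>u t z\<bar> \<le> M"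
      using u abs_le_sup_norm_time unfolding M_def by blast
    have "M \<ge> 0" using frontier_nonempty M[of 0] by fastforce
    obtain x where x: "BI_solution G a f x0 u x" using solution_exists x0 u by blast
    have u0: "u 0 z = x0 z" if "z \<in> frontier G" for z using Uad_boundary[OF x0] u that by blast
    have Nx0: "N x0 \<ge> 0" using x0 by (intro Lp_norm_nonneg G X_continuous)
    have "N (x t) - \<beta>' (N x0) t \<le> \<gamma>' m" if "m > M" for m
    proof -
      have "m \<ge> 0" using that \<open>M \<ge> 0\<close> by simp
      have estimate: "N (y t) \<le> \<beta> (8 * (N x0 + C * m)) t + \<gamma> m"
        if w: "w \<in> X" "\<And>z. z \<in> G \<Longrightarrow> \<bar>w z\<bar> \<le> \<bar>x0 z\<bar> + \<bar>c\<bar>" and c: "\<bar>c\<bar> = m" "\<forall>z\<in>frontier G. w z = c"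
          and y: "BI_solution G a f w (ext0_time (frontier G) (\<lambda>_. w)) y" for w c y
      proof -
        have "N w \<le> 4 * (N x0 + C * \<bar>c\<bar>)"
          by (rule N_le_add_const) (use w x0 X_continuous in auto)
        also have "\<dots> \<le> 8 * (N x0 + C * m)"
          using Nx0 C_nonneg \<open>m \<ge> 0\<close> c by simp
        finally have "\<beta> (N w) t \<le> \<beta> (8 * (N x0 + C * m)) t"
          using class_K_D(4)[OF class_KL_D(1)[OF \<beta> t]] Lp_norm_nonneg[OF G X_continuous[OF w(1)]] by blast
        then show ?thesis
          using bound[OF w(1) constant_input(1)[OF w(1) c(2)] t] constant_input(3)[OF w(1) c(2)]
            flow_eq[OF y] c(1) by simp
      qed
      have lt: "x0 z < m" "- 1 * x0 z < m" if "z \<in> frontier G" for z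
        using M[of 0 z] u0[OF that] \<open>m > M\<close> that by auto
      obtain w where w: "w \<in> X" "\<forall>z\<in>frontier G. w z = m" "\<And>z. z \<in> G \<Longrightarrow> x0 z \<le> w z"
          "\<And>z. z \<in> G \<Longrightarrow> \<bar>w z\<bar> \<le> \<bar>x0 z\<bar> + \<bar>m\<bar>"
        using upper_barrier[of x0 m, OF x0 lt(1)] by auto
      obtain v where v: "v \<in> X" "\<forall>z\<in>frontier G. v z = m" "\<And>z. z \<in> G \<Longrightarrow> - 1 * x0 z \<le> v z"
          "\<And>z. z \<in> G \<Longrightarrow> \<bar>v z\<bar> \<le> \<bar>- 1 * x0 z\<bar> + \<bar>m\<bar>"
        using upper_barrier[of "\<lambda>z. - 1 * x0 z" m, OF X_cmult[OF x0, of "- 1"] lt(2)] by auto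
      \<comment> \<open>The lower barrier is the negative of an upper barrier of \<open>- x0\<close>.\<close>
      define v' where "v' z = - 1 * v z" for z
      have v': "v' \<in> X" "\<forall>z\<in>frontier G. v' z = - m" "\<And>z. z \<in> G \<Longrightarrow> v' z \<le> x0 z"
        "\<And>z. z \<in> G \<Longrightarrow> \<bar>v' z\<bar> \<le> \<bar>x0 z\<bar> + \<bar>- m\<bar>"
        using X_cmult[OF v(1), of "- 1"] v(2) v(3,4) unfolding v'_def by force+
      obtain y where y: "BI_solution G a f w (ext0_time (frontier G) (\<lambda>_. w)) y"
        using solution_exists[OF w(1)] constant_input(1)[OF w(1,2)] by blast
      obtain y' where y': "BI_solution G a f v' (ext0_time (frontier G) (\<lambda>_. v')) y'"
        using solution_exists[OF v'(1)] constant_input(1)[OF v'(1,2)] by blast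
      have um: "- m \<le> u s z" "u s z \<le> m" if "s \<ge> 0" "z \<in> frontier G" for s z
        using M[OF that] \<open>m > M\<close> by auto
      have "x t z \<le> y t z" "y' t z \<le> x t z" if z: "z \<in> closure G" for z
        by (rule comparison_principle[OF setting H2 _ _ _ _ _ _ t z];
            use x y y' w v' um constant_input(2)[OF w(1,2)] constant_input(2)[OF v'(1,2)] in
            \<open>auto simp: BI_solution_def\<close>)+
      then have "\<bar>x t z\<bar> \<le> \<bar>y t z\<bar> + \<bar>y' t z\<bar>" if "z \<in> G" for z
        using in_closure(1)[OF that] by fastforce
      then have "N (x t) \<le> 4 * (N (y t) + N (y' t))"
        using x y y' t by (intro N_triangle) (auto intro: slice_continuous BI_solution_CL)
      also have "\<dots> \<le> 8 * (\<beta> (8 * (N x0 + C * m)) t + \<gamma> m)"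
        using estimate[OF w(1,4) _ w(2) y] estimate[OF v'(1,4) _ v'(2) y'] \<open>m \<ge> 0\<close> by simp
      also have "\<dots> \<le> 8 * (\<beta> (8 * (N x0 + C * m)) t + \<gamma> m + C * m)"
        using C_nonneg \<open>m \<ge> 0\<close> by simp
      also have "\<dots> \<le> \<beta>' (N x0) t + \<gamma>' m" by (rule absorb[OF Nx0 \<open>m \<ge> 0\<close> t])
      finally show ?thesis by simp
    qed
    then have "N (x t) - \<beta>' (N x0) t \<le> \<gamma>' M"
      by (rule class_K_le_limit[OF \<gamma>' \<open>M \<ge> 0\<close>])
    then show ?thesis using flow_eq[OF x] by (simp add: M_def)
  qed
  then show ?thesis unfolding BI_ISS_def ISS_def using \<beta>' \<gamma>' by blast
qed

lemma BI_ISS_imp_BI_ISS_const: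
  assumes "BI_ISS p G a f X Uad (boundary_inputs G)"
  shows "BI_ISS p G a f X Uad (const_boundary_inputs G)"
proof -
  have "const_boundary_inputs G \<subseteq> boundary_inputs G" by (auto simp: const_boundary_inputs_def)
  then show ?thesis using assms unfolding BI_ISS_def ISS_def by blast
qed

lemma BI_ISS_const_imp_DI_ISS:
  assumes "BI_ISS p G a f X Uad (const_boundary_inputs G)"
  shows "DI_ISS p G a f (zero_boundary_states G X) (const_distributed_inputs G)"
proof -
  obtain \<beta> \<gamma> where \<beta>: "\<beta> \<in> class_KL" and \<gamma>: "\<gamma> \<in> class_K"
    and bound: "\<And>x u t. x \<in> X \<Longrightarrow> u \<in> Uad x \<inter> const_boundary_inputs G \<Longrightarrow> t \<ge> 0 \<Longrightarrow>
      N (BI_flow G a f t x u) \<le> \<beta> (N x) t + \<gamma> (sup_norm_time (frontier G) u)"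
    using assms unfolding BI_ISS_def ISS_def by blast
  obtain \<beta>' \<gamma>' where \<beta>': "\<beta>' \<in> class_KL" and \<gamma>': "\<gamma>' \<in> class_K"
    and absorb: "\<And>r m t. r \<ge> 0 \<Longrightarrow> m \<ge> 0 \<Longrightarrow> t \<ge> 0 \<Longrightarrow>
      4 * (\<beta> (4 * (r + C * m)) t + \<gamma> m + C * m) \<le> \<beta>' r t + \<gamma>' m"
    using ISS_estimate_absorb[OF \<beta> \<gamma> _ C_nonneg, of 4] by auto
  have "N (DI_flow G a f t y0 v) \<le> \<beta>' (N y0) t + \<gamma>' (sup_norm_time (closure G) v)"
    if y0: "y0 \<in> zero_boundary_states G X" and v: "v \<in> const_distributed_inputs G" and t: "t \<ge> 0" for y0 v t
  proof -
    obtain c where c: "\<forall>t\<ge>0. \<forall>z\<in>closure G. v t z = c"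
      using v by (auto simp: const_distributed_inputs_def)
    have Nv: "sup_norm_time (closure G) v = \<bar>c\<bar>"
      using c G(3) by (intro sup_norm_time_const) auto
    have y0X: "y0 \<in> X" "\<forall>z\<in>frontier G. y0 z = 0" using y0 by (auto simp: zero_boundary_states_def)
    define x0 where "x0 = (\<lambda>z. y0 z + const c z)"
    have x0: "x0 \<in> X" unfolding x0_def by (intro X_add X_const y0X)
    have x0_eq: "x0 z = y0 z + c" if "z \<in> closure G" for z using that by (simp add: x0_def ext0_def)
    have x0c: "\<forall>z\<in>frontier G. x0 z = c" using y0X(2) x0_eq in_closure by simp
    define u where "u = ext0_time (frontier G) (\<lambda>_. x0)"
    note u = constant_input[OF x0 x0c, folded u_def]
    obtain x where x: "BI_solution G a f x0 u x" using solution_exists x0 u by blast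
    note cont_x = slice_continuous[OF BI_solution_CL[OF x] t]
    note cont = slice_continuous[OF translate_time_CL[OF G(1) BI_solution_CL[OF x], of c] t]
    have flow: "DI_flow G a f t y0 v = translate_time G c x t"
      by (rule DI_flow_eq[OF setting H2 c u(2) _ x]) (simp add: x0_eq in_closure)
    have Ny0: "N y0 \<ge> 0" using y0X by (intro Lp_norm_nonneg G X_continuous)
    have "N x0 \<le> 4 * (N y0 + C * \<bar>c\<bar>)"
      by (rule N_le_add_const[OF X_continuous[OF x0] X_continuous[OF y0X(1)]]) (simp add: x0_eq in_closure)
    then have "\<beta> (N x0) t \<le> \<beta> (4 * (N y0 + C * \<bar>c\<bar>)) t"
      using class_K_D(4)[OF class_KL_D(1)[OF \<beta> t]] Lp_norm_nonneg[OF G X_continuous[OF x0]] by blast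
    then have "N (x t) \<le> \<beta> (4 * (N y0 + C * \<bar>c\<bar>)) t + \<gamma> \<bar>c\<bar>"
      using bound[OF x0 u(1) t] flow_eq[OF x] u(3) by simp
    moreover have "N (translate_time G c x t) \<le> 4 * (N (x t) + C * \<bar>c\<bar>)"
      by (rule N_le_add_const[OF cont cont_x]) (simp add: translate_time_apply t in_closure)
    ultimately have "N (translate_time G c x t) \<le> 4 * (\<beta> (4 * (N y0 + C * \<bar>c\<bar>)) t + \<gamma> \<bar>c\<bar> + C * \<bar>c\<bar>)"
      by simp
    also have "\<dots> \<le> \<beta>' (N y0) t + \<gamma>' \<bar>c\<bar>" by (rule absorb[OF Ny0 abs_ge_zero t])
    finally show ?thesis by (simp add: flow Nv)
  qed
  then show ?thesis unfolding DI_ISS_def ISS_def using \<beta>' \<gamma>' by blast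
qed

lemma DI_ISS_imp_BI_ISS_const:
  assumes "DI_ISS p G a f (zero_boundary_states G X) (const_distributed_inputs G)"
  shows "BI_ISS p G a f X Uad (const_boundary_inputs G)"
proof -
  obtain \<beta> \<gamma> where \<beta>: "\<beta> \<in> class_KL" and \<gamma>: "\<gamma> \<in> class_K"
    and bound: "\<And>y v t. y \<in> zero_boundary_states G X \<Longrightarrow> v \<in> const_distributed_inputs G \<Longrightarrow> t \<ge> 0 \<Longrightarrow>
      N (DI_flow G a f t y v) \<le> \<beta> (N y) t + \<gamma> (sup_norm_time (closure G) v)"
    using assms unfolding DI_ISS_def ISS_def by blast
  obtain \<beta>' \<gamma>' where \<beta>': "\<beta>' \<in> class_KL" and \<gamma>': "\<gamma>' \<in> class_K"
    and absorb: "\<And>r m t. r \<ge> 0 \<Longrightarrow> m \<ge> 0 \<Longrightarrow> t \<ge> 0 \<Longrightarrow>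
      4 * (\<beta> (4 * (r + C * m)) t + \<gamma> m + C * m) \<le> \<beta>' r t + \<gamma>' m"
    using ISS_estimate_absorb[OF \<beta> \<gamma> _ C_nonneg, of 4] by auto
  have "N (BI_flow G a f t x0 u) \<le> \<beta>' (N x0) t + \<gamma>' (sup_norm_time (frontier G) u)"
    if x0: "x0 \<in> X" and u: "u \<in> Uad x0 \<inter> const_boundary_inputs G" and t: "t \<ge> 0" for x0 u t
  proof -
    obtain c where c: "\<forall>t\<ge>0. \<forall>z\<in>frontier G. u t z = c"
      using u by (auto simp: const_boundary_inputs_def)
    have Nu: "sup_norm_time (frontier G) u = \<bar>c\<bar>"
      using c frontier_nonempty by (intro sup_norm_time_const) auto
    have x0c: "x0 z = c" if "z \<in> frontier G" for z
      using Uad_boundary[OF x0] u c that by force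
    obtain x where x: "BI_solution G a f x0 u x" using solution_exists x0 u by blast
    define y0 where "y0 = (\<lambda>z. x0 z + const (- c) z)"
    have y0_eq: "y0 z = x0 z - c" if "z \<in> closure G" for z using that by (simp add: y0_def ext0_def)
    have y0X: "y0 \<in> X" unfolding y0_def by (intro X_add X_const x0)
    then have y0: "y0 \<in> zero_boundary_states G X"
      using y0_eq x0c in_closure by (simp add: zero_boundary_states_def)
    define v where "v = ext0_time (closure G) (\<lambda>_ _. c)"
    have vc: "\<forall>t\<ge>0. \<forall>z\<in>closure G. v t z = c" by (simp add: v_def ext0_time_def)
    have "continuous_on ({0..} \<times> closure G) (\<lambda>(t, z). v t z)"
      by (rule continuous_on_eq[of _ "\<lambda>_. c"]) (use vc in auto)
    moreover have "ext0_time (closure G) v = v" by (intro ext) (simp add: v_def ext0_time_def)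
    ultimately have v: "v \<in> const_distributed_inputs G"
      using vc by (auto simp: const_distributed_inputs_def C0_time_def)
    have Nv: "sup_norm_time (closure G) v = \<bar>c\<bar>"
      using vc G(3) by (intro sup_norm_time_const) auto
    note cont_x = slice_continuous[OF BI_solution_CL[OF x] t]
    note cont = slice_continuous[OF translate_time_CL[OF G(1) BI_solution_CL[OF x], of c] t]
    have flow: "DI_flow G a f t y0 v = translate_time G c x t"
      by (rule DI_flow_eq[OF setting H2 vc c _ x]) (simp add: y0_eq in_closure)
    have Nx0: "N x0 \<ge> 0" using x0 by (intro Lp_norm_nonneg G X_continuous)
    have "N y0 \<le> 4 * (N x0 + C * \<bar>c\<bar>)"
      by (rule N_le_add_const[OF X_continuous[OF y0X] X_continuous[OF x0]]) (simp add: y0_eq in_closure)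
    then have "\<beta> (N y0) t \<le> \<beta> (4 * (N x0 + C * \<bar>c\<bar>)) t"
      using class_K_D(4)[OF class_KL_D(1)[OF \<beta> t]] Lp_norm_nonneg[OF G X_continuous[OF y0X]] by blast
    then have "N (translate_time G c x t) \<le> \<beta> (4 * (N x0 + C * \<bar>c\<bar>)) t + \<gamma> \<bar>c\<bar>"
      using bound[OF y0 v t] flow Nv by simp
    moreover have "N (x t) \<le> 4 * (N (translate_time G c x t) + C * \<bar>c\<bar>)"
      by (rule N_le_add_const[OF cont_x cont]) (simp add: translate_time_apply t in_closure)
    ultimately have "N (x t) \<le> 4 * (\<beta> (4 * (N x0 + C * \<bar>c\<bar>)) t + \<gamma> \<bar>c\<bar> + C * \<bar>c\<bar>)"
      by simp
    also have "\<dots> \<le> \<beta>' (N x0) t + \<gamma>' \<bar>c\<bar>" by (rule absorb[OF Nx0 abs_ge_zero t])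
    finally show ?thesis by (simp add: flow_eq[OF x] Nu)
  qed
  then show ?thesis unfolding BI_ISS_def ISS_def using \<beta>' \<gamma>' by blast
qed

end

theorem mainTheorem4:
  fixes G :: "(real^'n::finite) set"
    and a :: "'n \<Rightarrow> 'n \<Rightarrow> real^'n \<Rightarrow> real"
    and f :: "real^'n \<Rightarrow> real \<Rightarrow> real^'n \<Rightarrow> real"
    and X :: "(real^'n \<Rightarrow> real) set"
    and Uad :: "(real^'n \<Rightarrow> real) \<Rightarrow> (real \<Rightarrow> real^'n \<Rightarrow> real) set"
    and p :: ereal
  assumes "parabolic_setting G a f"
    and "H1 G a f X Uad"
    and "H2 G f"
    and "H3 G X"
    and "1 \<le> p"
  shows "(BI_ISS p G a f X Uad (boundary_inputs G)
            \<longleftrightarrow> BI_ISS p G a f X Uad (const_boundary_inputs G)) \<and>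
         (BI_ISS p G a f X Uad (const_boundary_inputs G)
            \<longleftrightarrow> DI_ISS p G a f (zero_boundary_states G X) (const_distributed_inputs G))"
proof -
  interpret boundary_control_system G a f X Uad p
    by (unfold_locales) (fact assms)+
  show ?thesis
    using BI_ISS_imp_BI_ISS_const BI_ISS_const_imp_BI_ISS BI_ISS_const_imp_DI_ISS DI_ISS_imp_BI_ISS_const
    by blast
qed

end
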